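(* Let $W$ be a positive random variable and, for $n\ge 1$, let $W_1,\dots,W_n$ be independent copies of $W$. Let $G_n$ be the generalized random graph on the vertex set $\{1,\dots,n\}$ with vertex weights $W_1,\dots,W_n$: conditionally on $(W_1,\dots,W_n)$, each pair $\{i,j\}$ with $i\neq j$ is joined by an edge independently of all other pairs, with probability $$p_{ij}=\frac{W_iW_j}{L_n+W_iW_j},\qquad L_n=\sum_{i=1}^n W_i,$$ and there are no self-loops. Fix an integer $k\ge 3$ and let $S_n(k)$ be the number of cycles of length $k$ in $G_n$. Let $Z_k$ be a Poisson random variable with parameter $\lambda(k)=\frac{1}{2k}\left(\frac{\mathbb{E}W^2}{\mathbb{E}W}\right)^k$. If $$\mathbb{P}(W>x)=o(x^{-2k-1})\quad\text{as }x\to+\infty,$$ then $$\|\mathcal{L}(S_n(k))-\mathcal{L}(Z_k)\| = O(n^{-1/2})\quad\text{as } n\to\infty.$$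
   Context: A cycle of length $k$ is a set of $k$ distinct vertices $v_0,\dots,v_{k-1}$ with edges $v_0v_1, v_1v_2,\dots,v_{k-2}v_{k-1},v_{k-1}v_0$ all present; cycles are counted without regard to starting point or orientation, so there are $(n)_k/(2k)$ potential cycles of length $k$, where $(n)_k=n(n-1)\cdots(n-k+1)$. For non-negative integer-valued random variables $Y,Z$, $\|\mathcal{L}(Y)-\mathcal{L}(Z)\|=\sup_{\|h\|=1}|\mathbb{E}h(Y)-\mathbb{E}h(Z)|$, where the supremum is over real functions $h$ on $\{0,1,2,\dots\}$ with $\|h\|=\sup_{m\ge0}|h(m)|=1$. *)

theory Defs
  imports "HOL-Probability.Probability" "HOL-Library.Landau_Symbols"
begin

definition vpairs :: "nat \<Rightarrow> nat set set" where
  "vpairs n = {{i, j} | i j. 1 \<le> i \<and> i < j \<and> j \<le> n}"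

definition graphs :: "nat \<Rightarrow> nat set set set" where
  "graphs n = Pow (vpairs n)"

definition edge_prob :: "(nat \<Rightarrow> real) \<Rightarrow> nat \<Rightarrow> nat set \<Rightarrow> real" where
  "edge_prob w n e = (let L = (\<Sum>i=1..n. w i); q = (\<Prod>i\<in>e. w i) in q / (L + q))"

definition grg_prob :: "(nat \<Rightarrow> real) \<Rightarrow> nat \<Rightarrow> nat set set \<Rightarrow> real" where
  "grg_prob w n G = (\<Prod>e\<in>vpairs n. if e \<in> G then edge_prob w n e else 1 - edge_prob w n e)"

text \<open>Cycles of length k in G, each identified with its edge set
  (unordered, independent of starting point and orientation).\<close>
definition k_cycles :: "nat \<Rightarrow> nat \<Rightarrow> nat set set \<Rightarrow> nat set set set" where
  "k_cycles k n G = {C. \<exists>v. inj_on v {..<k} \<and> v ` {..<k} \<subseteq> {1..n} \<and>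
       C = (\<lambda>i. {v i, v (Suc i mod k)}) ` {..<k} \<and> C \<subseteq> G}"

definition num_cycles :: "nat \<Rightarrow> nat \<Rightarrow> nat set set \<Rightarrow> nat" where
  "num_cycles k n G = card (k_cycles k n G)"

definition expect_S :: "real measure \<Rightarrow> nat \<Rightarrow> nat \<Rightarrow> (nat \<Rightarrow> real) \<Rightarrow> real" where
  "expect_S mu n k h =
     (\<integral>w. (\<Sum>G\<in>graphs n. grg_prob w n G * h (num_cycles k n G)) \<partial>(PiM {1..n} (\<lambda>_. mu)))"

definition sup_norm_one :: "(nat \<Rightarrow> real) \<Rightarrow> bool" where
  "sup_norm_one h \<longleftrightarrow> bdd_above (range (\<lambda>m. \<bar>h m\<bar>)) \<and> (SUP m. \<bar>h m\<bar>) = 1"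

definition law_dist :: "real measure \<Rightarrow> nat \<Rightarrow> nat \<Rightarrow> real \<Rightarrow> real" where
  "law_dist mu n k lam =
     (SUP h \<in> {h. sup_norm_one h}.
        \<bar>expect_S mu n k h - measure_pmf.expectation (poisson_pmf lam) (\<lambda>m. h m)\<bar>)"

end

theory Submission
  imports Defs "HOL-Real_Asymp.Real_Asymp"
begin

text \<open>
  Fix the Poisson parameter \<open>lam\<close>. Its Stein equation has a solution bounded by \<open>2 * exp lam\<close>, and,
  given the weights, forcing a cycle \<open>A\<close> to be present amounts to adding its edges to the graph; this
  changes the cycle count by exactly one unless \<open>A\<close> was already there or some other cycle sharing an
  edge with \<open>A\<close> is completed. Hence the conditional error is at most a multiple of the distance of
  \<open>lam\<close> from the conditional mean plus the weight of overlapping pairs of cycles. The union of such a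
  pair has more edges than vertices and maximal degree at most 4, so if the total weight \<open>L\<close> is of
  order \<open>n\<close> the expected overlap is \<open>O(1/n)\<close> as soon as fourth moments exist. The conditional mean is,
  up to an error of the same kind, \<open>k! / (2 k)\<close> times the \<open>k\<close>-th elementary symmetric polynomial of the
  squared weights divided by \<open>L ^ k\<close>; variance bounds for this polynomial and for \<open>L\<close> give the rate
  \<open>n powr (-1/2)\<close>. The same variance bound disposes of the event that \<open>L\<close> is small.
\<close>

section \<open>The Stein equation of the Poisson distribution\<close>

text \<open>The comparison is with one fixed Poisson law although, given the weights, the mean
  number of cycles is itself random. The Stein equation of a fixed parameter pays for this linearly:
  the discrepancy of the means enters with a bounded factor and can be averaged over the weights
  afterwards. The obstacle is the total weight in the denominators, which is random and has no
  deterministic lower bound. It is met by an inequality that holds for every positive weight vector: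
  the conditional error is at most a combination of constants, squares of centred statistics and
  products of fourth powers divided by powers of a deterministic multiple of \<open>n\<close>. All
  of these can be integrated by independence, and no conditioning on a good event is ever carried
  out. Where the total weight is small the inequality survives because the error never exceeds 2,
  while a multiple of the squared fluctuation of \<open>L / n\<close> is at least 2 there. The
  overlaps cost only \<open>1 / n\<close>; the slower rate is that of the fluctuations of the
  conditional mean.\<close>

lemma poisson_expectation_sums:
  fixes h :: "nat \<Rightarrow> real"
  assumes h: "\<And>m. \<bar>h m\<bar> \<le> 1" and lam: "0 < lam"
  shows "(\<lambda>m. lam ^ m / fact m * exp (- lam) * h m) sums measure_pmf.expectation (poisson_pmf lam) h"
proof -
  have int: "integrable (measure_pmf (poisson_pmf lam)) h"
    by (rule measure_pmf.integrable_const_bound[where B = 1]) (use h in auto)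
  then have "integrable (count_space UNIV) (\<lambda>m. pmf (poisson_pmf lam) m * h m)"
    by (simp add: measure_pmf_eq_density integrable_density)
  from sums_integral_count_space_nat[OF this]
  have "(\<lambda>m. pmf (poisson_pmf lam) m * h m) sums (\<integral>m. pmf (poisson_pmf lam) m * h m \<partial>count_space UNIV)" .
  also have "(\<integral>m. pmf (poisson_pmf lam) m * h m \<partial>count_space UNIV) = measure_pmf.expectation (poisson_pmf lam) h"
    by (simp add: measure_pmf_eq_density integral_density)
  finally show ?thesis using pmf_poisson[OF lam] by simp
qed

lemma abs_poisson_expectation_le:
  fixes h :: "nat \<Rightarrow> real"
  assumes h: "\<And>m. \<bar>h m\<bar> \<le> 1"
  shows "\<bar>measure_pmf.expectation (poisson_pmf lam) h\<bar> \<le> 1"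
proof -
  have "\<bar>measure_pmf.expectation (poisson_pmf lam) h\<bar> \<le> measure_pmf.expectation (poisson_pmf lam) (\<lambda>m. \<bar>h m\<bar>)"
    by (rule integral_abs_bound)
  also have "\<dots> \<le> measure_pmf.expectation (poisson_pmf lam) (\<lambda>_. 1)"
    by (rule integral_mono) (use h in \<open>auto intro!: measure_pmf.integrable_const_bound[where B = 1]\<close>)
  finally show ?thesis by simp
qed

text \<open>Solving forwards from \<open>f 0 = 0\<close> gives a partial sum of the centred series
  \<open>a\<close> times \<open>fact j / lam ^ Suc j\<close>, a factor unbounded in
  \<open>j\<close>. Boundedness comes from the total sum of \<open>a\<close> being 0: the partial
  sum is minus the tail, whose terms carry \<open>1 / fact (i + Suc j)\<close>, and this absorbs
  \<open>fact j\<close>. What remains is the exponential series times the bound 2 for the centred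
  test function.\<close>

lemma poisson_stein_solution:
  fixes h :: "nat \<Rightarrow> real"
  assumes h: "\<And>m. \<bar>h m\<bar> \<le> 1" and lam: "0 < lam"
  obtains f :: "nat \<Rightarrow> real" where
    "\<And>j. lam * f (Suc j) - real j * f j = h j - measure_pmf.expectation (poisson_pmf lam) h"
    "\<And>j. \<bar>f j\<bar> \<le> 2 * exp lam"
proof -
  define P where "P = measure_pmf.expectation (poisson_pmf lam) h"
  define a where "a i = lam ^ i / fact i * (h i - P)" for i
  define f where "f j = (case j of 0 \<Rightarrow> 0 | Suc j \<Rightarrow> fact j / lam ^ Suc j * (\<Sum>i<Suc j. a i))" for j
  have bound: "\<bar>h i - P\<bar> \<le> 2" for i
    using h[of i] abs_poisson_expectation_le[of h lam, OF h] unfolding P_def by linarith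
  have exp_sums: "(\<lambda>i. lam ^ i / fact i) sums exp lam"
    using exp_converges[of lam] by (simp add: scaleR_conv_of_real field_simps)
  have "(\<lambda>m. exp lam * (lam ^ m / fact m * exp (- lam) * h m)) sums (exp lam * P)"
    unfolding P_def using poisson_expectation_sums[of h lam, OF h] lam by (intro sums_mult) auto
  then have "(\<lambda>m. lam ^ m / fact m * h m) sums (exp lam * P)"
    by (simp add: exp_minus field_simps)
  from sums_diff[OF this sums_mult2[OF exp_sums, of P]]
  have a_sums: "a sums 0"
    unfolding a_def by (simp add: algebra_simps diff_divide_distrib)
  have f_bound: "\<bar>f (Suc j)\<bar> \<le> 2 * exp lam" for j
  proof -
    let ?c = "fact j / lam ^ Suc j :: real"
    have tail: "(\<lambda>i. a (i + Suc j)) sums (- (\<Sum>i<Suc j. a i))"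
      using sums_split_initial_segment[OF a_sums, of "Suc j"] by simp
    have s: "(\<lambda>i. - (?c * a (i + Suc j))) sums f (Suc j)"
      using sums_minus[OF sums_mult[OF tail, of ?c]] by (simp add: f_def del: sum.lessThan_Suc)
    have le: "\<bar>- (?c * a (i + Suc j))\<bar> \<le> 2 * (lam ^ i / fact i)" for i
    proof -
      have "fact i * fact j \<le> (fact (i + j) :: real)"
        using fact_fact_dvd_fact[of i j] by (metis dvd_imp_le fact_gt_zero of_nat_fact of_nat_le_iff of_nat_mult)
      also have "\<dots> \<le> fact (i + Suc j)" by (intro fact_mono) auto
      finally have fact: "fact i * fact j \<le> (fact (i + Suc j) :: real)" .
      have "\<bar>?c * a (i + Suc j)\<bar> = fact j * lam ^ i / fact (i + Suc j) * \<bar>h (i + Suc j) - P\<bar>"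
        using lam by (simp add: a_def abs_mult power_add del: fact_Suc)
      also have "\<dots> \<le> fact j * lam ^ i / fact (i + Suc j) * 2"
        using lam bound by (intro mult_left_mono) auto
      also have "\<dots> \<le> lam ^ i / fact i * 2"
      proof (intro mult_right_mono)
        have "lam ^ i * (fact i * fact j) \<le> lam ^ i * fact (i + Suc j)"
          using lam fact by (intro mult_left_mono) auto
        then show "fact j * lam ^ i / fact (i + Suc j) \<le> lam ^ i / (fact i :: real)"
          by (simp add: divide_simps mult_ac del: fact_Suc)
      qed auto
      finally show ?thesis by (simp add: mult_ac)
    qed
    have e2: "(\<lambda>i. 2 * (lam ^ i / fact i)) sums (2 * exp lam)"
      using exp_sums by (rule sums_mult)
    have "norm (\<Sum>i. - (?c * a (i + Suc j))) \<le> (\<Sum>i. 2 * (lam ^ i / fact i))"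
      by (rule norm_suminf_le) (use le e2 in \<open>auto simp: sums_iff\<close>)
    then show ?thesis using s e2 by (simp add: sums_iff)
  qed
  show thesis
  proof (rule that[of f])
    fix j
    show "lam * f (Suc j) - real j * f j = h j - measure_pmf.expectation (poisson_pmf lam) h"
    proof (cases j)
      case 0
      then show ?thesis using lam by (simp add: f_def a_def P_def)
    next
      case (Suc i)
      have "lam * f (Suc j) = fact j / lam ^ j * (\<Sum>i<j. a i) + fact j / lam ^ j * a j"
        using lam by (simp add: f_def field_simps)
      also have "fact j / lam ^ j * (\<Sum>i<j. a i) = real j * f j"
        using Suc by (simp add: f_def)
      also have "fact j / lam ^ j * a j = h j - P" using lam by (simp add: a_def)
      finally show ?thesis by (simp add: P_def)
    qed
    show "\<bar>f j\<bar> \<le> 2 * exp lam"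
      using f_bound by (cases j) (auto simp: f_def)
  qed
qed

section \<open>Poisson approximation for a random subset\<close>

text \<open>Independent inclusions, kept as a finite sum of the same form as the inner sum of
  \<open>expect_S\<close>, so that no measure on graphs has to be built. The identities below hold
  for arbitrary real \<open>p\<close>; monotonicity is what asks for values in [0,1].\<close>

definition subset_expect :: "('e \<Rightarrow> real) \<Rightarrow> 'e set \<Rightarrow> ('e set \<Rightarrow> real) \<Rightarrow> real" where
  "subset_expect p E F = (\<Sum>G\<in>Pow E. (\<Prod>e\<in>E. if e \<in> G then p e else 1 - p e) * F G)"

lemma subset_expect_insert:
  assumes "finite E" "a \<notin> E"
  shows "subset_expect p (insert a E) F =
    (1 - p a) * subset_expect p E F + p a * subset_expect p E (\<lambda>G. F (insert a G))"
proof -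
  have inj: "inj_on (insert a) (Pow E)"
    using assms(2) by (auto simp: inj_on_def)
  have "subset_expect p (insert a E) F =
     (\<Sum>G\<in>Pow E. (\<Prod>e\<in>insert a E. if e \<in> G then p e else 1 - p e) * F G) +
     (\<Sum>G\<in>Pow E. (\<Prod>e\<in>insert a E. if e \<in> insert a G then p e else 1 - p e) * F (insert a G))"
    unfolding subset_expect_def Pow_insert
    by (subst sum.union_disjoint) (use assms in \<open>auto simp: sum.reindex[OF inj]\<close>)
  also have "(\<Sum>G\<in>Pow E. (\<Prod>e\<in>insert a E. if e \<in> G then p e else 1 - p e) * F G) =
     (1 - p a) * subset_expect p E F"
    unfolding subset_expect_def sum_distrib_left
    by (rule sum.cong) (use assms in auto)
  also have "(\<Sum>G\<in>Pow E. (\<Prod>e\<in>insert a E. if e \<in> insert a G then p e else 1 - p e) * F (insert a G)) =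
     p a * subset_expect p E (\<lambda>G. F (insert a G))"
    unfolding subset_expect_def sum_distrib_left
  proof (rule sum.cong[OF refl])
    fix G assume "G \<in> Pow E"
    have "(\<Prod>e\<in>E. if e \<in> insert a G then p e else 1 - p e) = (\<Prod>e\<in>E. if e \<in> G then p e else 1 - p e)"
      by (rule prod.cong) (use assms in auto)
    then show "(\<Prod>e\<in>insert a E. if e \<in> insert a G then p e else 1 - p e) * F (insert a G) =
      p a * ((\<Prod>e\<in>E. if e \<in> G then p e else 1 - p e) * F (insert a G))"
      using assms by simp
  qed
  finally show ?thesis .
qed

lemma subset_expect_const:
  assumes "finite E"
  shows "subset_expect p E (\<lambda>_. c) = c"
  using assms
proof (induction E)
  case empty
  then show ?case by (simp add: subset_expect_def)
next
  case (insert a E)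
  then show ?case by (simp add: subset_expect_insert algebra_simps)
qed

lemma subset_expect_diff: "subset_expect p E (\<lambda>G. F G - H G) = subset_expect p E F - subset_expect p E H"
  by (simp add: subset_expect_def algebra_simps sum_subtractf)

lemma subset_expect_cmult: "subset_expect p E (\<lambda>G. c * F G) = c * subset_expect p E F"
  by (simp add: subset_expect_def sum_distrib_left mult_ac)

lemma subset_expect_sum: "subset_expect p E (\<lambda>G. \<Sum>i\<in>I. F i G) = (\<Sum>i\<in>I. subset_expect p E (F i))"
  unfolding subset_expect_def sum_distrib_left by (rule sum.swap)

lemma subset_expect_mono:
  assumes "\<And>e. e \<in> E \<Longrightarrow> 0 \<le> p e \<and> p e \<le> 1" "\<And>G. G \<subseteq> E \<Longrightarrow> F G \<le> H G"
  shows "subset_expect p E F \<le> subset_expect p E H"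
  unfolding subset_expect_def
  by (intro sum_mono mult_left_mono prod_nonneg) (use assms in auto)

lemma subset_expect_cong:
  assumes "\<And>G. G \<subseteq> E \<Longrightarrow> F G = H G"
  shows "subset_expect p E F = subset_expect p E H"
  unfolding subset_expect_def by (intro sum.cong) (use assms in auto)

lemma subset_expect_abs_le:
  assumes p: "\<And>e. e \<in> E \<Longrightarrow> 0 \<le> p e \<and> p e \<le> 1"
  shows "\<bar>subset_expect p E F\<bar> \<le> subset_expect p E (\<lambda>G. \<bar>F G\<bar>)"
proof -
  have "subset_expect p E F \<le> subset_expect p E (\<lambda>G. \<bar>F G\<bar>)"
    by (intro subset_expect_mono p) auto
  moreover have "subset_expect p E (\<lambda>G. (-1) * F G) \<le> subset_expect p E (\<lambda>G. \<bar>F G\<bar>)"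
    by (intro subset_expect_mono p) auto
  ultimately show ?thesis unfolding subset_expect_cmult by auto
qed

text \<open>By independence, conditioning on \<open>A \<subseteq> G\<close> has the same effect as
  adding \<open>A\<close> to \<open>G\<close>. Multiplying by the indicator instead of conditioning
  keeps this valid when \<open>A\<close> has probability 0. The induction is over all
  \<open>F\<close> because the indicator of the new element is absorbed into
  \<open>F\<close>.\<close>

lemma subset_expect_superset:
  assumes "finite E" "A \<subseteq> E"
  shows "subset_expect p E (\<lambda>G. of_bool (A \<subseteq> G) * F G) = (\<Prod>e\<in>A. p e) * subset_expect p E (\<lambda>G. F (G \<union> A))"
proof -
  have "finite A" using assms finite_subset by blast
  then show ?thesis using assms(2)
  proof (induction A arbitrary: F)
    case empty
    then show ?case by simp
  next
    case (insert a A)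
    have single: "subset_expect p E (\<lambda>G. of_bool (a \<in> G) * H G) = p a * subset_expect p E (\<lambda>G. H (insert a G))" for H
    proof -
      obtain E' where E': "E = insert a E'" "a \<notin> E'"
        using insert.prems by (metis insert_subset mk_disjoint_insert)
      have "finite E'" using assms(1) E' by simp
      moreover have "subset_expect p E' (\<lambda>G. of_bool (a \<in> G) * H G) = subset_expect p E' (\<lambda>_. 0)"
        by (rule subset_expect_cong) (use E' in auto)
      ultimately show ?thesis
        using E' by (simp add: subset_expect_insert subset_expect_const algebra_simps)
    qed
    have "subset_expect p E (\<lambda>G. of_bool (insert a A \<subseteq> G) * F G) =
      subset_expect p E (\<lambda>G. of_bool (A \<subseteq> G) * (of_bool (a \<in> G) * F G))"
      by (rule subset_expect_cong) auto
    also have "\<dots> = (\<Prod>e\<in>A. p e) * subset_expect p E (\<lambda>G. of_bool (a \<in> G \<union> A) * F (G \<union> A))"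
      using insert.prems by (subst insert.IH) auto
    also have "subset_expect p E (\<lambda>G. of_bool (a \<in> G \<union> A) * F (G \<union> A)) =
       subset_expect p E (\<lambda>G. of_bool (a \<in> G) * F (G \<union> A))"
      by (rule subset_expect_cong) (use insert.hyps in auto)
    also have "\<dots> = p a * subset_expect p E (\<lambda>G. F (G \<union> insert a A))"
      by (subst single) simp
    finally show ?case using insert.hyps by (simp add: mult_ac)
  qed
qed

lemma subset_expect_subset:
  assumes "finite E" "A \<subseteq> E"
  shows "subset_expect p E (\<lambda>G. of_bool (A \<subseteq> G)) = (\<Prod>e\<in>A. p e)"
  using subset_expect_superset[OF assms, of p "\<lambda>_. 1"] assms(1)
  by (simp add: subset_expect_const)

text \<open>Probability of \<open>A\<close> times the probability that \<open>B\<close> may disturb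
  the count when \<open>A\<close> is forced in. For \<open>B \<noteq> A\<close> this is the product
  over \<open>A \<union> B\<close>, the probability that both are present; for \<open>B = A\<close>
  the disturbance is that \<open>A\<close> was there already, which gives a square.\<close>

definition overlap_weight :: "('e \<Rightarrow> real) \<Rightarrow> 'e set \<Rightarrow> 'e set \<Rightarrow> real" where
  "overlap_weight p A B = (\<Prod>e\<in>A. p e) * (\<Prod>e\<in>(if A = B then A else B - A). p e)"

text \<open>A member other than \<open>A\<close> that becomes complete must meet \<open>A\<close>.
  The witness only has to satisfy \<open>B - A \<subseteq> G\<close>, even if \<open>B\<close> was
  complete before: this larger event is a containment, so its probability is a plain
  product.\<close>

lemma card_supersets_union_ne:
  assumes fin: "finite \<Gamma>" and A: "A \<in> \<Gamma>" and ne: "card {B\<in>\<Gamma>. B \<subseteq> G \<union> A} \<noteq> Suc (card {B\<in>\<Gamma>. B \<subseteq> G})"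
  shows "\<exists>B\<in>\<Gamma>. (if A = B then A else B - A) \<subseteq> G \<and> (A \<inter> B \<noteq> {} \<or> A = B)"
proof (rule ccontr)
  assume no: "\<not> ?thesis"
  have "{B\<in>\<Gamma>. B \<subseteq> G \<union> A} = insert A {B\<in>\<Gamma>. B \<subseteq> G}"
  proof (intro equalityI subsetI)
    fix B assume B: "B \<in> {B\<in>\<Gamma>. B \<subseteq> G \<union> A}"
    show "B \<in> insert A {B\<in>\<Gamma>. B \<subseteq> G}"
    proof (cases "B = A")
      case False
      then have "B - A \<subseteq> G" using B by auto
      then have "A \<inter> B = {}" using no B False by auto
      then show ?thesis using B by auto
    qed simp
  next
    fix B assume "B \<in> insert A {B\<in>\<Gamma>. B \<subseteq> G}"
    then show "B \<in> {B\<in>\<Gamma>. B \<subseteq> G \<union> A}" using A by auto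
  qed
  moreover have "A \<notin> {B\<in>\<Gamma>. B \<subseteq> G}" using no A by (metis (mono_tags, lifting) mem_Collect_eq)
  ultimately show False using ne fin by simp
qed

text \<open>The Stein identity splits the error into \<open>lam - lamn\<close> times a bounded
  expectation and, for each \<open>A\<close>, the difference of \<open>f\<close> at one more than
  the old count and at the count with \<open>A\<close> forced in. The difference vanishes off the
  events measured by \<open>overlap_weight\<close>; on them it is at most twice the bound for
  \<open>f\<close>. The parameter \<open>lam\<close> is kept apart from the mean because the mean
  will vary with the weights.\<close>

lemma poisson_approx_random_subset:
  fixes p :: "'e \<Rightarrow> real" and h :: "nat \<Rightarrow> real"
  assumes E: "finite E" and p: "\<And>e. e \<in> E \<Longrightarrow> 0 \<le> p e \<and> p e \<le> 1"
    and \<Gamma>: "finite \<Gamma>" "\<And>A. A \<in> \<Gamma> \<Longrightarrow> A \<subseteq> E"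
    and h: "\<And>m. \<bar>h m\<bar> \<le> 1" and lam: "0 < lam"
  shows "\<bar>subset_expect p E (\<lambda>G. h (card {A\<in>\<Gamma>. A \<subseteq> G})) - measure_pmf.expectation (poisson_pmf lam) h\<bar>
    \<le> 2 * exp lam * (\<bar>lam - (\<Sum>A\<in>\<Gamma>. \<Prod>e\<in>A. p e)\<bar> +
        2 * (\<Sum>A\<in>\<Gamma>. \<Sum>B\<in>{B\<in>\<Gamma>. A \<inter> B \<noteq> {} \<or> A = B}. overlap_weight p A B))"
proof -
  define P where "P = measure_pmf.expectation (poisson_pmf lam) h"
  define S where "S G = card {A\<in>\<Gamma>. A \<subseteq> G}" for G :: "'e set"
  define lamn where "lamn = (\<Sum>A\<in>\<Gamma>. \<Prod>e\<in>A. p e)"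
  define N where "N A = {B\<in>\<Gamma>. A \<inter> B \<noteq> {} \<or> A = B}" for A
  let ?E = "subset_expect p E" and ?K = "2 * exp lam"
  obtain f where f: "\<And>j. lam * f (Suc j) - real j * f j = h j - P" "\<And>j. \<bar>f j\<bar> \<le> ?K"
    using poisson_stein_solution[of h lam, OF h lam] unfolding P_def by metis
  have S_sum: "real (S G) = (\<Sum>A\<in>\<Gamma>. of_bool (A \<subseteq> G))" for G
    using \<Gamma>(1) by (simp add: S_def sum.If_cases of_bool_def Int_def)
  have E1: "?E (\<lambda>G. real (S G) * f (S G)) = (\<Sum>A\<in>\<Gamma>. (\<Prod>e\<in>A. p e) * ?E (\<lambda>G. f (S (G \<union> A))))"
    unfolding S_sum sum_distrib_right subset_expect_sum
    by (intro sum.cong refl subset_expect_superset E \<Gamma>)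
  have E2: "lamn * ?E (\<lambda>G. f (Suc (S G))) = (\<Sum>A\<in>\<Gamma>. (\<Prod>e\<in>A. p e) * ?E (\<lambda>G. f (Suc (S G))))"
    by (simp add: lamn_def sum_distrib_right)
  have "?E (\<lambda>G. h (S G)) - P = ?E (\<lambda>G. h (S G) - P)"
    by (simp add: subset_expect_diff subset_expect_const E)
  also have "\<dots> = ?E (\<lambda>G. lam * f (Suc (S G)) - real (S G) * f (S G))"
    by (simp add: f)
  also have "\<dots> = (lam - lamn) * ?E (\<lambda>G. f (Suc (S G))) +
      (\<Sum>A\<in>\<Gamma>. (\<Prod>e\<in>A. p e) * ?E (\<lambda>G. f (Suc (S G)) - f (S (G \<union> A))))"
    unfolding subset_expect_diff subset_expect_cmult E1
    using E2 by (simp add: algebra_simps sum_subtractf)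
  finally have eq: "?E (\<lambda>G. h (S G)) - P = (lam - lamn) * ?E (\<lambda>G. f (Suc (S G))) +
      (\<Sum>A\<in>\<Gamma>. (\<Prod>e\<in>A. p e) * ?E (\<lambda>G. f (Suc (S G)) - f (S (G \<union> A))))" .
  have "\<bar>?E (\<lambda>G. f (Suc (S G)))\<bar> \<le> ?E (\<lambda>G. \<bar>f (Suc (S G))\<bar>)"
    using p by (rule subset_expect_abs_le)
  also have "\<dots> \<le> ?E (\<lambda>_. ?K)" using p f by (intro subset_expect_mono) auto
  finally have b1: "\<bar>?E (\<lambda>G. f (Suc (S G)))\<bar> \<le> ?K" by (simp add: subset_expect_const E)
  have b2: "\<bar>(\<Prod>e\<in>A. p e) * ?E (\<lambda>G. f (Suc (S G)) - f (S (G \<union> A)))\<bar> \<le>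
     2 * ?K * (\<Sum>B\<in>N A. overlap_weight p A B)" if A: "A \<in> \<Gamma>" for A
  proof -
    let ?D = "\<lambda>B. if A = B then A else B - A"
    have pA: "0 \<le> (\<Prod>e\<in>A. p e)" using p \<Gamma>(2)[OF A] by (intro prod_nonneg) auto
    have "\<bar>?E (\<lambda>G. f (Suc (S G)) - f (S (G \<union> A)))\<bar> \<le> ?E (\<lambda>G. \<bar>f (Suc (S G)) - f (S (G \<union> A))\<bar>)"
      using p by (rule subset_expect_abs_le)
    also have "\<dots> \<le> ?E (\<lambda>G. (2 * ?K) * (\<Sum>B\<in>N A. of_bool (?D B \<subseteq> G)))"
    proof (rule subset_expect_mono[OF p])
      fix G
      show "\<bar>f (Suc (S G)) - f (S (G \<union> A))\<bar> \<le> (2 * ?K) * (\<Sum>B\<in>N A. of_bool (?D B \<subseteq> G))"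
      proof (cases "S (G \<union> A) = Suc (S G)")
        case True
        then show ?thesis by (auto intro!: mult_nonneg_nonneg sum_nonneg)
      next
        case False
        then obtain B where B: "B \<in> N A" "?D B \<subseteq> G"
          using card_supersets_union_ne[OF \<Gamma>(1) A] unfolding S_def N_def by blast
        have "1 = (of_bool (?D B \<subseteq> G) :: real)" using B by simp
        also have "\<dots> \<le> (\<Sum>B\<in>N A. of_bool (?D B \<subseteq> G))"
          by (rule member_le_sum) (use B \<Gamma>(1) in \<open>auto simp: N_def\<close>)
        finally have "2 * ?K * 1 \<le> (2 * ?K) * (\<Sum>B\<in>N A. of_bool (?D B \<subseteq> G))"
          by (intro mult_left_mono) auto
        moreover have "\<bar>f (Suc (S G)) - f (S (G \<union> A))\<bar> \<le> 2 * ?K"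
          using f(2)[of "Suc (S G)"] f(2)[of "S (G \<union> A)"] by linarith
        ultimately show ?thesis by linarith
      qed
    qed
    also have "\<dots> = 2 * ?K * (\<Sum>B\<in>N A. ?E (\<lambda>G. of_bool (?D B \<subseteq> G)))"
      by (simp add: subset_expect_cmult subset_expect_sum)
    also have "(\<Sum>B\<in>N A. ?E (\<lambda>G. of_bool (?D B \<subseteq> G))) = (\<Sum>B\<in>N A. \<Prod>e\<in>?D B. p e)"
      by (intro sum.cong refl subset_expect_subset E) (use \<Gamma> in \<open>auto simp: N_def split: if_splits\<close>)
    finally have "(\<Prod>e\<in>A. p e) * \<bar>?E (\<lambda>G. f (Suc (S G)) - f (S (G \<union> A)))\<bar> \<le>
       (\<Prod>e\<in>A. p e) * (2 * ?K * (\<Sum>B\<in>N A. \<Prod>e\<in>?D B. p e))"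
      using pA by (rule mult_left_mono)
    then show ?thesis
      using pA by (simp add: abs_mult overlap_weight_def sum_distrib_left mult_ac)
  qed
  have "\<bar>?E (\<lambda>G. h (S G)) - P\<bar> \<le> \<bar>(lam - lamn) * ?E (\<lambda>G. f (Suc (S G)))\<bar> +
      \<bar>\<Sum>A\<in>\<Gamma>. (\<Prod>e\<in>A. p e) * ?E (\<lambda>G. f (Suc (S G)) - f (S (G \<union> A)))\<bar>"
    unfolding eq by (rule abs_triangle_ineq)
  also have "\<dots> \<le> \<bar>lam - lamn\<bar> * ?K + (\<Sum>A\<in>\<Gamma>. 2 * ?K * (\<Sum>B\<in>N A. overlap_weight p A B))"
    unfolding abs_mult using b1 b2 by (intro add_mono mult_left_mono order.trans[OF sum_abs] sum_mono) auto
  finally show ?thesis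
    unfolding P_def S_def lamn_def N_def by (simp add: sum_distrib_left algebra_simps)
qed

section \<open>Cycles as edge sets\<close>

definition cycle_edges :: "nat \<Rightarrow> (nat \<Rightarrow> 'a) \<Rightarrow> 'a set set" where
  "cycle_edges k v = (\<lambda>i. {v i, v (Suc i mod k)}) ` {..<k}"

lemma Suc_mod_ne:
  assumes "2 \<le> k" "i < k"
  shows "Suc i mod k \<noteq> i"
  using assms by (cases "Suc i = k") auto

lemma Suc_Suc_mod_ne:
  assumes "3 \<le> k" "i < k"
  shows "Suc (Suc i mod k) mod k \<noteq> i"
  using assms by (cases "Suc i = k"; cases "Suc (Suc i) = k") auto

lemma Suc_mod_inj:
  assumes "i < k" "j < k" "Suc i mod k = Suc j mod k"
  shows "i = j"
  using assms by (cases "Suc i = k"; cases "Suc j = k") auto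

text \<open>Two steps forward never return to the start when \<open>k \<ge> 3\<close>, so no edge is
  traversed from both of its ends; with \<open>k = 2\<close> it would be.\<close>

lemma cycle_edge_eq_iff:
  assumes k: "3 \<le> k" and v: "inj_on v {..<k}" and ij: "i < k" "j < k"
  shows "{v i, v (Suc i mod k)} = {v j, v (Suc j mod k)} \<longleftrightarrow> i = j"
proof
  assume eq: "{v i, v (Suc i mod k)} = {v j, v (Suc j mod k)}"
  have v_eq: "v a = v b \<longleftrightarrow> a = b" if "a < k" "b < k" for a b
    using v that by (auto simp: inj_on_def)
  have lt: "Suc i mod k < k" "Suc j mod k < k" using k by auto
  have "i = j \<or> i = Suc j mod k \<and> Suc i mod k = j"
    using eq v_eq ij lt by (auto simp: doubleton_eq_iff)
  then show "i = j" using Suc_Suc_mod_ne[OF k ij(1)] by auto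
qed simp

lemma card_cycle_edges:
  assumes "3 \<le> k" "inj_on v {..<k}"
  shows "card (cycle_edges k v) = k"
proof -
  have "inj_on (\<lambda>i. {v i, v (Suc i mod k)}) {..<k}"
    using cycle_edge_eq_iff[OF assms] by (auto simp: inj_on_def)
  then show ?thesis unfolding cycle_edges_def by (simp add: card_image)
qed

lemma Union_cycle_edges:
  assumes "0 < k"
  shows "\<Union>(cycle_edges k v) = v ` {..<k}"
  using assms unfolding cycle_edges_def by auto

lemma bij_betw_Suc_mod:
  assumes "0 < k"
  shows "bij_betw (\<lambda>i. Suc i mod k) {..<k} {..<k}"
proof -
  have inj: "inj_on (\<lambda>i. Suc i mod k) {..<k}"
    by (auto simp: inj_on_def intro: Suc_mod_inj)
  moreover have "(\<lambda>i. Suc i mod k) ` {..<k} = {..<k}"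
    by (rule endo_inj_surj[OF _ _ inj]) (use assms in auto)
  ultimately show ?thesis by (simp add: bij_betw_def)
qed

text \<open>Every vertex lies on exactly two edges of its cycle, as the start of one step and the
  end of another. This is how squares of the weights, and hence the second moment in the Poisson
  parameter, arise.\<close>

lemma prod_cycle_edges:
  fixes q :: "'a \<Rightarrow> 'b :: comm_monoid_mult"
  assumes k: "3 \<le> k" and v: "inj_on v {..<k}"
  shows "(\<Prod>e\<in>cycle_edges k v. \<Prod>x\<in>e. q x) = (\<Prod>x\<in>\<Union>(cycle_edges k v). q x ^ 2)"
proof -
  have inj: "inj_on (\<lambda>i. {v i, v (Suc i mod k)}) {..<k}"
    using cycle_edge_eq_iff[OF assms] by (auto simp: inj_on_def)
  have "(\<Prod>e\<in>cycle_edges k v. \<Prod>x\<in>e. q x) = (\<Prod>i<k. \<Prod>x\<in>{v i, v (Suc i mod k)}. q x)"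
    unfolding cycle_edges_def by (simp add: prod.reindex[OF inj])
  also have "\<dots> = (\<Prod>i<k. q (v i) * q (v (Suc i mod k)))"
  proof (rule prod.cong[OF refl])
    fix i assume "i \<in> {..<k}"
    then have "v i \<noteq> v (Suc i mod k)"
      using Suc_mod_ne[of k i] v k by (auto simp: inj_on_def)
    then show "(\<Prod>x\<in>{v i, v (Suc i mod k)}. q x) = q (v i) * q (v (Suc i mod k))" by simp
  qed
  also have "\<dots> = (\<Prod>i<k. q (v i)) * (\<Prod>i<k. q (v (Suc i mod k)))"
    by (rule prod.distrib)
  also have "(\<Prod>i<k. q (v (Suc i mod k))) = (\<Prod>i<k. q (v i))"
    using prod.reindex_bij_betw[OF bij_betw_Suc_mod[of k], of "\<lambda>i. q (v i)"] k by simp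
  also have "(\<Prod>i<k. q (v i)) * (\<Prod>i<k. q (v i)) = (\<Prod>i<k. q (v i) ^ 2)"
    by (simp add: prod.distrib power2_eq_square)
  also have "\<dots> = (\<Prod>x\<in>\<Union>(cycle_edges k v). q x ^ 2)"
    using k by (simp add: Union_cycle_edges prod.reindex[OF v])
  finally show ?thesis .
qed

section \<open>Potential cycles, and pairs of them sharing an edge\<close>

lemma cycle_edges_subset_vpairs:
  assumes k: "2 \<le> k" and v: "inj_on v {..<k}" "v ` {..<k} \<subseteq> {1..n}"
  shows "cycle_edges k v \<subseteq> vpairs n"
proof
  fix e assume "e \<in> cycle_edges k v"
  then obtain i where i: "i < k" "e = {v i, v (Suc i mod k)}" by (auto simp: cycle_edges_def)
  have lt: "Suc i mod k < k" using k by simp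
  have "v i \<noteq> v (Suc i mod k)"
    using Suc_mod_ne[OF k i(1)] inj_onD[OF v(1), of i "Suc i mod k"] i(1) lt by auto
  moreover have "v i \<in> {1..n}" "v (Suc i mod k) \<in> {1..n}"
    using v(2) i(1) lt by (auto simp only: image_subset_iff lessThan_iff)
  ultimately show "e \<in> vpairs n"
  proof (cases "v i < v (Suc i mod k)")
    case True
    then show ?thesis using i(2) \<open>v i \<in> {1..n}\<close> \<open>v (Suc i mod k) \<in> {1..n}\<close>
      unfolding vpairs_def by (intro CollectI exI[of _ "v i"] exI[of _ "v (Suc i mod k)"]) simp
  next
    case False
    then show ?thesis using i(2) \<open>v i \<in> {1..n}\<close> \<open>v (Suc i mod k) \<in> {1..n}\<close> \<open>v i \<noteq> v (Suc i mod k)\<close>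
      unfolding vpairs_def by (intro CollectI exI[of _ "v (Suc i mod k)"] exI[of _ "v i"]) (simp add: insert_commute)
  qed
qed

lemma finite_vpairs: "finite (vpairs n)"
  by (rule finite_subset[of _ "Pow {1..n}"]) (auto simp: vpairs_def)

text \<open>The cycles of the complete graph. They do not depend on the random graph, which enters
  only through containment, as the approximation for random subsets demands.\<close>

definition complete_cycles :: "nat \<Rightarrow> nat \<Rightarrow> nat set set set" where
  "complete_cycles k n = {cycle_edges k v | v. inj_on v {..<k} \<and> v ` {..<k} \<subseteq> {1..n}}"

lemma complete_cycles_subset:
  assumes "2 \<le> k" "C \<in> complete_cycles k n"
  shows "C \<subseteq> vpairs n"
proof -
  obtain v where "inj_on v {..<k}" "v ` {..<k} \<subseteq> {1..n}" "C = cycle_edges k v"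
    using assms(2) by (auto simp: complete_cycles_def)
  then show ?thesis using cycle_edges_subset_vpairs[OF assms(1)] by simp
qed

lemma finite_complete_cycles:
  assumes "2 \<le> k"
  shows "finite (complete_cycles k n)"
  by (rule finite_subset[of _ "Pow (vpairs n)"])
    (use complete_cycles_subset[OF assms] in \<open>auto simp: finite_vpairs\<close>)

lemma k_cycles_eq: "k_cycles k n G = {C \<in> complete_cycles k n. C \<subseteq> G}"
  unfolding k_cycles_def complete_cycles_def cycle_edges_def by blast

text \<open>Otherwise the walk around the circle from \<open>i0\<close> would never enter
  \<open>J\<close>, yet it reaches \<open>j0\<close> after \<open>k - i0 + j0\<close> steps.\<close>

lemma exists_cyclic_entry:
  assumes i0: "i0 < k" "i0 \<notin> J" and j0: "j0 < k" "j0 \<in> J"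
  shows "\<exists>i<k. i \<notin> J \<and> Suc i mod k \<in> J"
proof (rule ccontr)
  assume no: "\<not> ?thesis"
  have "(i0 + t) mod k \<notin> J" for t
  proof (induction t)
    case 0
    then show ?case using i0 by simp
  next
    case (Suc t)
    moreover have "(i0 + t) mod k < k" using i0 by simp
    ultimately have "Suc ((i0 + t) mod k) mod k \<notin> J" using no by blast
    then show ?case by (simp add: mod_Suc_eq)
  qed
  from this[of "k - i0 + j0"] have "j0 \<notin> J" using i0 j0 by simp
  then show False using j0 by simp
qed

text \<open>Two distinct overlapping cycles form a connected graph with at least two independent cycles.\<close>

lemma card_Un_cycle_edges:
  assumes k: "3 \<le> k" and a: "inj_on a {..<k}" and b: "inj_on b {..<k}"
    and ne: "cycle_edges k a \<noteq> cycle_edges k b" and int: "cycle_edges k a \<inter> cycle_edges k b \<noteq> {}"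
  shows "card (\<Union>(cycle_edges k a) \<union> \<Union>(cycle_edges k b)) < card (cycle_edges k a \<union> cycle_edges k b)"
proof -
  let ?A = "cycle_edges k a" and ?B = "cycle_edges k b"
  let ?e = "\<lambda>i. {b i, b (Suc i mod k)}"
  have fin: "finite ?A" "finite ?B" by (auto simp: cycle_edges_def)
  have UA: "\<Union>?A = a ` {..<k}" and UB: "\<Union>?B = b ` {..<k}" using k by (auto simp: Union_cycle_edges)
  define J where "J = {j. j < k \<and> b j \<notin> \<Union>?A}"
  have Jk: "J \<subseteq> {..<k}" and finJ: "finite J" by (auto simp: J_def)
  have diff: "\<Union>?B - \<Union>?A = b ` J" unfolding UB J_def by auto
  then have card_diff: "card (\<Union>?B - \<Union>?A) = card J"
    using card_image[OF inj_on_subset[OF b Jk]] by simp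
  have out: "?e j \<in> ?B - ?A" if "j < k" "j \<in> J \<or> Suc j mod k \<in> J" for j
    using that unfolding J_def cycle_edges_def[of k b] by blast
  \<comment> \<open>The first cycle has at least as many edges as vertices, so it suffices that the
    second brings strictly more new edges than new vertices. Without new vertices there is still a
    new edge, since cycles of equal length are not properly nested. Otherwise each new vertex brings
    the edge leaving it, and the edge at \<open>i\<close> through which the new vertices are entered
    is one more.\<close>
  have "card J < card (?B - ?A)"
  proof (cases "J = {}")
    case True
    have "?B - ?A \<noteq> {}"
    proof
      assume "?B - ?A = {}"
      then have "?B \<subseteq> ?A" by auto
      with ne fin have "card ?B < card ?A" by (intro psubset_card_mono) auto
      then show False using card_cycle_edges[OF k a] card_cycle_edges[OF k b] by simp
    qed
    then show ?thesis using True fin by (simp add: card_gt_0_iff)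
  next
    case False
    obtain e where "e \<in> ?A" "e \<in> ?B" using int by auto
    then obtain i0 where "i0 < k" "b i0 \<in> \<Union>?A" unfolding cycle_edges_def[of k b] by blast
    moreover obtain j0 where "j0 \<in> J" "j0 < k" using False Jk by auto
    ultimately obtain i where i: "i < k" "i \<notin> J" "Suc i mod k \<in> J"
      using exists_cyclic_entry[of i0 k J j0] by (auto simp: J_def)
    have "?e ` insert i J \<subseteq> ?B - ?A"
      using out i Jk by auto
    moreover have "inj_on ?e (insert i J)"
    proof (rule inj_onI)
      fix x y assume "x \<in> insert i J" "y \<in> insert i J" "?e x = ?e y"
      then show "x = y" using cycle_edge_eq_iff[OF k b, of x y] i(1) Jk by auto
    qed
    ultimately have "card (insert i J) \<le> card (?B - ?A)"
      using fin by (intro card_inj_on_le[where f = ?e]) auto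
    then show ?thesis using i(2) finJ by simp
  qed
  moreover have "card (\<Union>?A) \<le> card ?A"
    using card_cycle_edges[OF k a] card_image_le[of "{..<k}" a] by (simp add: UA)
  moreover have "card (?A \<union> ?B) = card ?A + card (?B - ?A)"
    using fin by (metis Un_Diff_cancel card_Un_disjoint Diff_disjoint finite_Diff)
  moreover have "card (\<Union>?A \<union> \<Union>?B) = card (\<Union>?A) + card (\<Union>?B - \<Union>?A)"
    unfolding UA UB by (metis Un_Diff_cancel card_Un_disjoint Diff_disjoint finite_Diff finite_imageI finite_lessThan)
  ultimately show ?thesis using card_diff by linarith
qed

section \<open>The number of cycles through a given vertex set\<close>

text \<open>The dihedral relabellings of a cycle: start at \<open>r\<close> and walk with step \<open>s = 1\<close> or \<open>s = k - 1\<close>.\<close>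

definition rotate_cycle :: "nat \<Rightarrow> (nat \<Rightarrow> 'a) \<Rightarrow> nat \<times> nat \<Rightarrow> nat \<Rightarrow> 'a" where
  "rotate_cycle k v = (\<lambda>(r, s). restrict (\<lambda>i. v ((r + s * i) mod k)) {..<k})"

text \<open>The steps 1 and \<open>k - 1\<close> are coprime to \<open>k\<close>, so multiplying by
  them is injective modulo \<open>k\<close>.\<close>

lemma step_mod_inj:
  fixes k s i j :: nat
  assumes s: "s = 1 \<or> s = k - 1" and ij: "i < k" "j < k" and eq: "(r + s * i) mod k = (r + s * j) mod k"
  shows "i = j"
proof -
  have "coprime (int s) (int k)"
    using s ij coprime_diff_one_left_nat[of k] by auto
  moreover have "int k dvd int s * (int i - int j)"
  proof -
    have "(int (r + s * i)) mod int k = (int (r + s * j)) mod int k"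
      using eq by (metis of_nat_mod)
    then have "int k dvd int (r + s * i) - int (r + s * j)"
      by (rule mod_eq_dvd_iff[THEN iffD1])
    then show ?thesis by (simp add: algebra_simps)
  qed
  ultimately have "int k dvd int i - int j"
    by (metis coprime_commute coprime_dvd_mult_right_iff)
  then have "int i mod int k = int j mod int k"
    by (rule mod_eq_dvd_iff[THEN iffD2])
  then show ?thesis using ij by simp
qed

text \<open>In any labelling of the same cycle consecutive vertices are neighbours, so the position
  along \<open>v\<close> moves one place forwards or backwards each time. Injectivity forbids
  turning back, so the first move decides the direction. Starting point and direction give
  \<open>k\<close> times 2 choices, which differ because \<open>1 \<noteq> k - 1\<close>.\<close>

lemma card_cycle_labellings:
  assumes k: "3 \<le> k" and v: "v \<in> {..<k} \<rightarrow>\<^sub>E V" "inj_on v {..<k}" and cV: "card V = k"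
  shows "card {w \<in> {..<k} \<rightarrow>\<^sub>E V. inj_on w {..<k} \<and> cycle_edges k w = cycle_edges k v} = 2 * k"
proof -
  let ?D = "{..<k} \<times> {1, k - 1}"
  let ?F = "{w \<in> {..<k} \<rightarrow>\<^sub>E V. inj_on w {..<k} \<and> cycle_edges k w = cycle_edges k v}"
  have v_eq: "v a = v b \<longleftrightarrow> a = b" if "a < k" "b < k" for a b
    using v(2) that by (auto simp: inj_on_def)
  have finV: "finite V" using cV k by (metis card.infinite not_numeral_le_zero)
  have vV: "v ` {..<k} = V"
    using finV v cV by (intro card_subset_eq) (auto simp: card_image)
  have inj: "inj_on (rotate_cycle k v) ?D"
  proof (rule inj_onI)
    fix x y assume xy: "x \<in> ?D" "y \<in> ?D" "rotate_cycle k v x = rotate_cycle k v y"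
    obtain r s r' s' where x: "x = (r, s)" and y: "y = (r', s')" by fastforce
    have rs: "r \<in> {..<k}" "s \<in> {1, k - 1}" "r' \<in> {..<k}" "s' \<in> {1, k - 1}"
      and eq: "rotate_cycle k v (r, s) = rotate_cycle k v (r', s')"
      using xy unfolding x y by auto
    have e: "(r + s * i) mod k = (r' + s' * i) mod k" if "i < k" for i
      using fun_cong[OF eq, of i] that k by (simp add: rotate_cycle_def v_eq)
    have r: "r = r'" using e[of 0] rs k by simp
    have "s < k" "s' < k" using rs(2,4) k by auto
    \<comment> \<open>Injectivity is applied with step 1 and with \<open>s\<close> and
      \<open>s'\<close> as positions; the factor 1 is written out for this purpose.\<close>
    have "(r + 1 * s) mod k = (r + 1 * s') mod k" using e[of 1] r k by simp
    then have "s = s'" by (rule step_mod_inj[rotated 3]) (use \<open>s < k\<close> \<open>s' < k\<close> in auto)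
    with r show "x = y" by (simp add: x y)
  qed
  have mem: "rotate_cycle k v (r, s) \<in> ?F" if rs: "r < k" "s \<in> {1, k - 1}" for r s
  proof -
    let ?w = "rotate_cycle k v (r, s)"
    have w: "?w i = v ((r + s * i) mod k)" if "i < k" for i using that by (simp add: rotate_cycle_def)
    have ext: "?w \<in> {..<k} \<rightarrow>\<^sub>E V"
      using k vV by (auto simp: rotate_cycle_def)
    have injw: "inj_on ?w {..<k}"
    proof (rule inj_onI)
      fix i j assume ij: "i \<in> {..<k}" "j \<in> {..<k}" "?w i = ?w j"
      then have "(r + s * i) mod k = (r + s * j) mod k" using k by (simp add: w v_eq)
      then show "i = j" using step_mod_inj[of s k i j r] rs ij by auto
    qed
    have sub: "cycle_edges k ?w \<subseteq> cycle_edges k v"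
    proof
      fix e assume "e \<in> cycle_edges k ?w"
      then obtain i where i: "i < k" "e = {?w i, ?w (Suc i mod k)}" by (auto simp: cycle_edges_def)
      have "(r + s * (Suc i mod k)) mod k = (r + s * i + s) mod k"
        by (metis (no_types, lifting) ab_semigroup_add_class.add_ac(1) add.commute mod_add_right_eq mod_mult_right_eq mult_Suc_right)
      then have e: "e = {v ((r + s * i) mod k), v ((r + s * i + s) mod k)}"
        using i k by (simp add: w)
      show "e \<in> cycle_edges k v"
      proof (cases "s = 1")
        case True
        have "e = {v ((r + i) mod k), v (Suc ((r + i) mod k) mod k)}"
          using e True by (simp add: mod_Suc_eq)
        then show ?thesis unfolding cycle_edges_def using k by auto
      next
        case False
        then have s: "s = k - 1" using rs by auto
        have "Suc (r + s * i + s) = r + s * i + k" using s k by simp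
        then have "Suc ((r + s * i + s) mod k) mod k = (r + s * i) mod k"
          by (metis mod_Suc_eq mod_add_self2)
        then have "e = {v ((r + s * i + s) mod k), v (Suc ((r + s * i + s) mod k) mod k)}"
          using e by auto
        then show ?thesis unfolding cycle_edges_def using k by auto
      qed
    qed
    have "cycle_edges k ?w = cycle_edges k v"
      by (rule card_subset_eq[OF _ sub]) (auto simp: cycle_edges_def card_cycle_edges[OF k, unfolded cycle_edges_def] injw v(2))
    then show ?thesis using ext injw by simp
  qed
  have surj: "w \<in> rotate_cycle k v ` ?D" if w: "w \<in> ?F" for w
  proof -
    have wV: "w i \<in> V" if "i < k" for i using w that by auto
    have "\<forall>i. \<exists>j. i < k \<longrightarrow> j < k \<and> w i = v j"
      using wV vV by (metis imageE lessThan_iff)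
    then obtain \<sigma> where \<sigma>: "\<And>i. i < k \<Longrightarrow> \<sigma> i < k \<and> w i = v (\<sigma> i)" by metis
    have \<sigma>_inj: "\<sigma> i \<noteq> \<sigma> j" if "i < k" "j < k" "i \<noteq> j" for i j
      using w \<sigma> that by (metis (mono_tags, lifting) inj_onD lessThan_iff mem_Collect_eq)
    have adj: "\<sigma> (Suc i) = Suc (\<sigma> i) mod k \<or> \<sigma> i = Suc (\<sigma> (Suc i)) mod k" if i: "Suc i < k" for i
    proof -
      have "{w i, w (Suc i)} \<in> cycle_edges k w"
        unfolding cycle_edges_def using i by (intro image_eqI[of _ _ i]) auto
      then obtain j where j: "j < k" "{w i, w (Suc i)} = {v j, v (Suc j mod k)}"
        using w by (auto simp: cycle_edges_def)
      have "{v (\<sigma> i), v (\<sigma> (Suc i))} = {v j, v (Suc j mod k)}"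
        using j(2) \<sigma> i by simp
      moreover have "Suc j mod k < k" using k by simp
      ultimately show ?thesis
        using \<sigma>[of i] \<sigma>[of "Suc i"] i j(1) v_eq by (auto simp: doubleton_eq_iff)
    qed
    \<comment> \<open>Adding \<open>k - 1\<close> is one place backwards modulo \<open>k\<close>,
      without a subtraction from \<open>y\<close> that could be cut off at 0.\<close>
    have prev: "x = (y + (k - 1)) mod k" if "y = Suc x mod k" "x < k" for x y
      using that by (cases "Suc x = k") (auto simp: mod_if)
    obtain s where s: "s \<in> {1, k - 1}" "\<sigma> 1 = (\<sigma> 0 + s) mod k"
    proof -
      have "\<sigma> 1 = (\<sigma> 0 + 1) mod k \<or> \<sigma> 1 = (\<sigma> 0 + (k - 1)) mod k"
        using adj[of 0] prev[where x = "\<sigma> 1" and y = "\<sigma> 0"] \<sigma>[of 1] k by auto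
      then show ?thesis using that by blast
    qed
    have step: "\<sigma> i = (\<sigma> 0 + s * i) mod k \<and> \<sigma> (Suc i) = (\<sigma> i + s) mod k" if "Suc i < k" for i
      using that
    proof (induction i)
      case 0
      then show ?case using s \<sigma>[of 0] by simp
    next
      case (Suc i)
      have IH: "\<sigma> i = (\<sigma> 0 + s * i) mod k" "\<sigma> (Suc i) = (\<sigma> i + s) mod k" using Suc by auto
      have lt: "\<sigma> i < k" "\<sigma> (Suc i) < k" "\<sigma> (Suc (Suc i)) < k" using \<sigma> Suc.prems by auto
      \<comment> \<open>No turning back: one of the two neighbouring positions of
        \<open>\<sigma> (Suc i)\<close> is taken by \<open>\<sigma> i\<close>, which leaves the one
        in the same direction.\<close>
      have ne: "\<sigma> (Suc (Suc i)) \<noteq> \<sigma> i" using \<sigma>_inj Suc.prems by simp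
      have "\<sigma> (Suc (Suc i)) = (\<sigma> (Suc i) + s) mod k"
      proof (cases "s = 1")
        case True
        have "\<sigma> (Suc i) \<noteq> Suc (\<sigma> (Suc (Suc i))) mod k"
        proof
          assume "\<sigma> (Suc i) = Suc (\<sigma> (Suc (Suc i))) mod k"
          then have "Suc (\<sigma> (Suc (Suc i))) mod k = Suc (\<sigma> i) mod k" using IH True by simp
          then show False using Suc_mod_inj[OF lt(3,1)] ne by simp
        qed
        then show ?thesis using adj[OF Suc.prems] True by simp
      next
        case False
        then have s': "s = k - 1" using s by simp
        have "Suc (\<sigma> i + s) = \<sigma> i + k" using s' k by simp
        then have "Suc (\<sigma> (Suc i)) mod k = \<sigma> i" using IH(2) lt by (metis mod_Suc_eq mod_add_self2 mod_less)
        then have "\<sigma> (Suc i) = Suc (\<sigma> (Suc (Suc i))) mod k" using adj[OF Suc.prems] ne by simp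
        then show ?thesis using prev[where y = "\<sigma> (Suc i)" and x = "\<sigma> (Suc (Suc i))"] lt s' by simp
      qed
      moreover have "\<sigma> (Suc i) = (\<sigma> 0 + s * Suc i) mod k"
        using IH by (simp add: mod_simps algebra_simps)
      ultimately show ?case by simp
    qed
    have \<sigma>_eq: "\<sigma> i = (\<sigma> 0 + s * i) mod k" if i: "i < k" for i
    proof (cases i)
      case 0
      then show ?thesis using \<sigma>[of 0] k by simp
    next
      case (Suc i')
      then show ?thesis using step[of i'] i by (simp add: mod_simps algebra_simps)
    qed
    have "w = rotate_cycle k v (\<sigma> 0, s)"
    proof
      fix i show "w i = rotate_cycle k v (\<sigma> 0, s) i"
        using w \<sigma>[of i] \<sigma>_eq[of i] by (cases "i < k") (auto simp: rotate_cycle_def PiE_def extensional_def)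
    qed
    moreover have "(\<sigma> 0, s) \<in> ?D" using \<sigma>[of 0] s k by auto
    ultimately show ?thesis by blast
  qed
  have "?F = rotate_cycle k v ` ?D"
    using mem surj by auto
  then have "card ?F = card ?D" using card_image[OF inj] by simp
  also have "\<dots> = 2 * k" using k by (simp add: card_cartesian_product card_insert_if)
  finally show ?thesis .
qed

lemma card_injective_labellings:
  assumes "finite S" "finite T" "card S = card T"
  shows "card {f \<in> S \<rightarrow>\<^sub>E T. inj_on f S} = fact (card T)"
  using assms
proof (induction S arbitrary: T rule: finite_induct)
  case empty
  then show ?case by (simp add: PiE_empty_domain Collect_conv_if)
next
  case (insert x S)
  let ?I = "\<lambda>T. {f \<in> S \<rightarrow>\<^sub>E T. inj_on f S}"
  have "{f \<in> insert x S \<rightarrow>\<^sub>E T. inj_on f (insert x S)} = (\<lambda>(y, g). g(x := y)) ` Sigma T (\<lambda>y. ?I (T - {y}))"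
    using extensional_funcset_extend_domain_inj_on_eq[OF insert.hyps(2), of T] by auto
  moreover have "inj_on (\<lambda>(y, g). g(x := y)) (Sigma T (\<lambda>y. ?I (T - {y})))"
    using extensional_funcset_extend_domain_inj_onI[OF insert.hyps(2), of T]
    by (rule inj_on_subset) auto
  ultimately have "card {f \<in> insert x S \<rightarrow>\<^sub>E T. inj_on f (insert x S)} = card (Sigma T (\<lambda>y. ?I (T - {y})))"
    by (simp add: card_image)
  also have "\<dots> = (\<Sum>y\<in>T. card (?I (T - {y})))"
  proof (rule card_SigmaI)
    have "finite (S \<rightarrow>\<^sub>E (T - {y}))" for y
      using insert by (intro finite_PiE) auto
    then show "\<forall>y\<in>T. finite (?I (T - {y}))" by (simp add: finite_subset)
  qed (use insert in auto)
  also have "\<dots> = (\<Sum>y\<in>T. fact (card T - 1))"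
  proof (rule sum.cong[OF refl])
    fix y assume y: "y \<in> T"
    have "card S = card (T - {y})" using insert y by simp
    then have "card (?I (T - {y})) = fact (card (T - {y}))" using insert by simp
    then show "card (?I (T - {y})) = fact (card T - 1)" using y insert by simp
  qed
  also have "\<dots> = fact (card T)"
  proof -
    have "card T = Suc (card S)" using insert by simp
    then show ?thesis by simp
  qed
  finally show ?case .
qed

text \<open>Double counting of the \<open>fact k\<close> injective labellings of \<open>V\<close>,
  of which each cycle accounts for \<open>2 * k\<close>. The product form avoids a division of
  natural numbers.\<close>

lemma card_complete_cycles_on:
  assumes k: "3 \<le> k" and V: "V \<subseteq> {1..n}" "card V = k"
  shows "2 * k * card {C \<in> complete_cycles k n. \<Union>C = V} = fact k"
proof -
  let ?I = "{f \<in> {..<k} \<rightarrow>\<^sub>E V. inj_on f {..<k}}"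
  let ?C = "{C \<in> complete_cycles k n. \<Union>C = V}"
  have finV: "finite V" using V finite_subset by blast
  have "?C = cycle_edges k ` ?I"
  proof (intro equalityI subsetI)
    fix C assume "C \<in> ?C"
    then obtain v where v: "inj_on v {..<k}" "C = cycle_edges k v" "\<Union>C = V"
      by (auto simp: complete_cycles_def)
    have "v ` {..<k} = V" using v k Union_cycle_edges[of k v] by simp
    then have "restrict v {..<k} \<in> ?I" using v(1) by auto
    moreover have "cycle_edges k (restrict v {..<k}) = C"
      unfolding v cycle_edges_def using k by (intro image_cong) auto
    ultimately show "C \<in> cycle_edges k ` ?I" by blast
  next
    fix C assume "C \<in> cycle_edges k ` ?I"
    then obtain v where v: "v \<in> {..<k} \<rightarrow>\<^sub>E V" "inj_on v {..<k}" "C = cycle_edges k v" by auto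
    have "v ` {..<k} = V"
      using finV v V by (intro card_subset_eq) (auto simp: card_image)
    then show "C \<in> ?C"
      using v V k by (auto simp: complete_cycles_def Union_cycle_edges)
  qed
  moreover have finI: "finite ?I"
    using finV by (auto intro!: finite_subset[OF _ finite_PiE[of "{..<k}" "\<lambda>_. V"]])
  ultimately have "card ?I = (\<Sum>C\<in>?C. card {f \<in> ?I. cycle_edges k f = C})"
    using card_eq_sum[of ?I] sum.image_gen[OF finI, of "\<lambda>_. 1 :: nat" "cycle_edges k"] by simp
  also have "\<dots> = (\<Sum>C\<in>?C. 2 * k)"
  proof (rule sum.cong[OF refl])
    fix C assume "C \<in> ?C"
    then obtain v where v: "v \<in> {..<k} \<rightarrow>\<^sub>E V" "inj_on v {..<k}" "C = cycle_edges k v"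
      using \<open>?C = cycle_edges k ` ?I\<close> by auto
    have "{f \<in> ?I. cycle_edges k f = C} =
       {w \<in> {..<k} \<rightarrow>\<^sub>E V. inj_on w {..<k} \<and> cycle_edges k w = cycle_edges k v}"
      using v by auto
    then show "card {f \<in> ?I. cycle_edges k f = C} = 2 * k"
      using card_cycle_labellings[OF k v(1,2) V(2)] by simp
  qed
  finally show ?thesis
    using card_injective_labellings[of "{..<k}" V] finV V by simp
qed

section \<open>Moment estimates\<close>

text \<open>For \<open>k \<ge> 3\<close> the tail decays faster than \<open>x powr (-7)\<close>, and
  \<open>x powr (-6)\<close> already makes the sum of \<open>(j + 1) ^ 4\<close> times the tail at
  \<open>j\<close> converge like the sum of \<open>1 / j ^ 2\<close>. The fourth power is below this
  layered sum because it is below the single layer that contains \<open>x\<close>.\<close>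

lemma integrable_power4_of_tail:
  fixes mu :: "real measure"
  assumes "prob_space mu" and sets: "sets mu = sets borel" and pos: "AE x in mu. x > 0" and k: "3 \<le> k"
    and tail: "(\<lambda>x. measure mu {y. y > x}) \<in> o[at_top](\<lambda>x. x powr (- (2 * real k + 1)))"
  shows "integrable mu (\<lambda>x. x ^ 4)"
proof -
  interpret prob_space mu by fact
  have [measurable_cong]: "sets mu = sets borel" by fact
  define g where "g j = (real j + 1) ^ 4 * measure mu {y. y > real j}" for j :: nat
  have "(\<lambda>x. x powr (- (2 * real k + 1))) \<in> O[at_top](\<lambda>x. x powr (-6))"
    using k by (intro bigoI[of _ 1] eventually_mono[OF eventually_ge_at_top[of 1]]) (auto intro!: powr_mono)
  with tail have "(\<lambda>x. measure mu {y. y > x}) \<in> O[at_top](\<lambda>x. x powr (-6))"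
    by (meson landau_o.big_trans landau_o.small_imp_big)
  then have "(\<lambda>j. measure mu {y. y > real j}) \<in> O[sequentially](\<lambda>j. real j powr (-6))"
    using filterlim_real_sequentially by (rule landau_o.big.compose)
  then have "g \<in> O[sequentially](\<lambda>j. (real j + 1) ^ 4 * real j powr (-6))"
    unfolding g_def by (intro landau_o.big.mult) auto
  also have "(\<lambda>j. (real j + 1) ^ 4 * real j powr (-6)) \<in> O[sequentially](\<lambda>j. 1 / real j ^ 2)"
    by real_asymp
  finally have "summable g"
    by (rule summable_comparison_test_bigo[rotated])
      (use inverse_power_summable[of 2, where 'a = real] in \<open>simp add: inverse_eq_divide\<close>)
  have g_nonneg: "0 \<le> g j" for j by (simp add: g_def)
  have "(\<integral>\<^sup>+ x. ennreal (norm (x ^ 4)) \<partial>mu) \<le> (\<integral>\<^sup>+ x. (\<Sum>j. ennreal ((real j + 1) ^ 4) * indicator {y. y > real j} x) \<partial>mu)"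
  proof (rule nn_integral_mono_AE)
    show "AE x in mu. ennreal (norm (x ^ 4)) \<le> (\<Sum>j. ennreal ((real j + 1) ^ 4) * indicator {y. y > real j} x)"
      using pos
    proof eventually_elim
      fix x :: real assume x: "x > 0"
      \<comment> \<open>The layer with \<open>j < x \<le> j + 1\<close>. The ceiling is taken
        because the tail is that of a strict inequality, which the floor would miss at
        integers.\<close>
      define j where "j = nat (\<lceil>x\<rceil> - 1)"
      have "real j = of_int \<lceil>x\<rceil> - 1" using x by (simp add: j_def)
      then have j: "real j < x" "x \<le> real j + 1" by linarith+
      have "ennreal (norm (x ^ 4)) \<le> ennreal ((real j + 1) ^ 4) * indicator {y. y > real j} x"
        using x j by (auto intro!: ennreal_leI power_mono)
      also have "\<dots> \<le> (\<Sum>j. ennreal ((real j + 1) ^ 4) * indicator {y. y > real j} x)"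
      proof -
        define t where "t j = ennreal ((real j + 1) ^ 4) * indicator {y. y > real j} x" for j
        have "sum t {j} \<le> suminf t" by (rule sum_le_suminf) auto
        then have "t j \<le> suminf t" by simp
        then show ?thesis unfolding t_def .
      qed
      finally show "ennreal (norm (x ^ 4)) \<le> (\<Sum>j. ennreal ((real j + 1) ^ 4) * indicator {y. y > real j} x)" .
    qed
  qed
  also have "\<dots> = (\<Sum>j. \<integral>\<^sup>+ x. ennreal ((real j + 1) ^ 4) * indicator {y. y > real j} x \<partial>mu)"
    by (rule nn_integral_suminf) measurable
  also have "\<dots> = (\<Sum>j. ennreal (g j))"
    by (intro suminf_cong) (simp add: nn_integral_cmult_indicator sets g_def emeasure_eq_measure ennreal_mult')
  also have "\<dots> < \<infinity>"
    using \<open>summable g\<close> g_nonneg by (simp add: suminf_ennreal2)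
  finally show ?thesis by (intro integrableI_bounded) auto
qed

section \<open>Products of independent weights under a fourth moment\<close>

locale iid_weights = prob_space mu for mu :: "real measure" +
  assumes sets_mu [measurable_cong]: "sets mu = sets borel"
    and integrable_power4: "integrable mu (\<lambda>x. x ^ 4)"
begin

abbreviation weights :: "nat \<Rightarrow> (nat \<Rightarrow> real) measure" where
  "weights n \<equiv> PiM {1..n} (\<lambda>_. mu)"

text \<open>The lower bound 1 makes powers increase with the exponent and products increase with the
  index set. Mixed products of low powers can then be padded to one form, fourth powers over a
  vertex set, whose expectation is a power of \<open>moment4\<close>.\<close>

definition majorant :: "real \<Rightarrow> real" where
  "majorant x = max 1 \<bar>x\<bar>"

definition moment4 :: real where
  "moment4 = (\<integral>x. majorant x ^ 4 \<partial>mu)"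

lemma majorant_ge_1: "1 \<le> majorant x" by (simp add: majorant_def)

lemma abs_le_majorant: "\<bar>x\<bar> \<le> majorant x" by (simp add: majorant_def)

lemma measurable_majorant [measurable]: "majorant \<in> borel_measurable borel"
  unfolding majorant_def by measurable

lemma integrable_majorant: "integrable mu (\<lambda>x. majorant x ^ 4)"
proof (rule Bochner_Integration.integrable_bound)
  show "integrable mu (\<lambda>x. 1 + x ^ 4)" using integrable_power4 by simp
  show "AE x in mu. norm (majorant x ^ 4) \<le> norm (1 + x ^ 4)"
  proof (rule AE_I2)
    fix x :: real
    have "majorant x ^ 4 \<le> 1 + x ^ 4"
      unfolding majorant_def max_def by simp
    moreover have "0 \<le> majorant x ^ 4" using majorant_ge_1[of x] by simp
    ultimately show "norm (majorant x ^ 4) \<le> norm (1 + x ^ 4)" by simp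
  qed
qed measurable

lemma moment4_ge_1: "1 \<le> moment4"
proof -
  have "(\<integral>x. 1 \<partial>mu) \<le> moment4" unfolding moment4_def
    by (rule integral_mono) (use integrable_majorant majorant_ge_1 in \<open>auto simp: one_le_power\<close>)
  then show ?thesis by (simp add: prob_space)
qed

lemma integrable_le_majorant:
  fixes f :: "real \<Rightarrow> real"
  assumes [measurable]: "f \<in> borel_measurable borel" and "\<And>x. \<bar>f x\<bar> \<le> majorant x ^ 2"
  shows "integrable mu f"
proof (rule Bochner_Integration.integrable_bound[OF integrable_majorant])
  show "AE x in mu. norm (f x) \<le> norm (majorant x ^ 4)"
  proof (rule AE_I2)
    fix x
    have "majorant x ^ 2 \<le> majorant x ^ 4"
      by (rule power_increasing) (auto simp: majorant_ge_1)
    then show "norm (f x) \<le> norm (majorant x ^ 4)" using assms(2)[of x] by simp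
  qed
qed measurable

lemma prod_component:
  fixes f :: "real \<Rightarrow> real"
  assumes f: "integrable mu f" and V: "V \<subseteq> {1..n}"
  shows integrable_prod_component: "integrable (weights n) (\<lambda>w. \<Prod>i\<in>V. f (w i))"
    and integral_prod_component: "(\<integral>w. (\<Prod>i\<in>V. f (w i)) \<partial>weights n) = (\<integral>x. f x \<partial>mu) ^ card V"
proof -
  interpret product_sigma_finite "\<lambda>_ :: nat. mu" by standard
  \<comment> \<open>Padding with the constant 1 outside \<open>V\<close> changes neither product nor
    integral, since \<open>mu\<close> has total mass 1.\<close>
  let ?f = "\<lambda>i x. if i \<in> V then f x else 1"
  have eq: "(\<Prod>i\<in>V. f (w i)) = (\<Prod>i\<in>{1..n}. ?f i (w i))" for w
    using V by (intro prod.mono_neutral_cong_left) auto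
  have int: "integrable mu (?f i)" for i using f by (cases "i \<in> V") auto
  show "integrable (weights n) (\<lambda>w. \<Prod>i\<in>V. f (w i))"
    unfolding eq using int by (intro product_integrable_prod) auto
  have "(\<integral>w. (\<Prod>i\<in>V. f (w i)) \<partial>weights n) = (\<Prod>i\<in>{1..n}. \<integral>x. ?f i x \<partial>mu)"
    unfolding eq using int by (intro product_integral_prod) auto
  also have "\<dots> = (\<Prod>i\<in>V. \<integral>x. f x \<partial>mu)"
    using V by (intro prod.mono_neutral_cong_right) (auto simp: prob_space)
  finally show "(\<integral>w. (\<Prod>i\<in>V. f (w i)) \<partial>weights n) = (\<integral>x. f x \<partial>mu) ^ card V" by simp
qed

text \<open>Indices common to both sets carry the power 2 + 2 = 4, and the others are padded up to
  it. This is what calls for four moments.\<close>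

lemma prod_mult_prod_le:
  fixes f :: "real \<Rightarrow> real"
  assumes f: "\<And>x. \<bar>f x\<bar> \<le> majorant x ^ 2" and fin: "finite V" "finite V'"
  shows "\<bar>(\<Prod>i\<in>V. f (w i)) * (\<Prod>i\<in>V'. f (w i))\<bar> \<le> (\<Prod>i\<in>V \<union> V'. majorant (w i) ^ 4)"
proof -
  have le: "\<bar>\<Prod>i\<in>X. f (w i)\<bar> \<le> (\<Prod>i\<in>V \<union> V'. majorant (w i) ^ 2)" if "X \<subseteq> V \<union> V'" for X
  proof -
    have "\<bar>\<Prod>i\<in>X. f (w i)\<bar> \<le> (\<Prod>i\<in>X. majorant (w i) ^ 2)"
      unfolding abs_prod by (intro prod_mono) (auto simp: f)
    also have "\<dots> \<le> (\<Prod>i\<in>V \<union> V'. majorant (w i) ^ 2)"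
      by (intro prod_mono2) (use fin that in \<open>auto simp: one_le_power majorant_ge_1\<close>)
    finally show ?thesis .
  qed
  have "\<bar>(\<Prod>i\<in>V. f (w i)) * (\<Prod>i\<in>V'. f (w i))\<bar> \<le>
      (\<Prod>i\<in>V \<union> V'. majorant (w i) ^ 2) * (\<Prod>i\<in>V \<union> V'. majorant (w i) ^ 2)"
    unfolding abs_mult by (intro mult_mono le) (auto intro: prod_nonneg)
  also have "\<dots> = (\<Prod>i\<in>V \<union> V'. majorant (w i) ^ 4)"
    by (simp add: prod.distrib[symmetric] power_add[symmetric])
  finally show ?thesis .
qed

end

section \<open>Elementary symmetric polynomials and their variance\<close>

definition subsets_of_card :: "nat \<Rightarrow> nat \<Rightarrow> nat set set" where
  "subsets_of_card n r = {V. V \<subseteq> {1..n} \<and> card V = r}"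

definition elem_sym :: "nat \<Rightarrow> nat \<Rightarrow> (nat \<Rightarrow> real) \<Rightarrow> real" where
  "elem_sym n r x = (\<Sum>V\<in>subsets_of_card n r. \<Prod>i\<in>V. x i)"

lemma finite_subsets_of_card: "finite (subsets_of_card n r)"
  unfolding subsets_of_card_def by (rule finite_subset[of _ "Pow {1..n}"]) auto

lemma card_subsets_of_card: "card (subsets_of_card n r) = n choose r"
  unfolding subsets_of_card_def by (subst n_subsets) auto

lemma choose_le_power: "n choose r \<le> n ^ r"
  by (cases "r \<le> n") (auto intro: binomial_le_pow simp: binomial_eq_0)

lemma elem_sym_1: "elem_sym n 1 x = (\<Sum>i=1..n. x i)"
proof -
  have "subsets_of_card n 1 = (\<lambda>i. {i}) ` {1..n}"
    unfolding subsets_of_card_def by (auto simp: card_1_singleton_iff)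
  then show ?thesis unfolding elem_sym_def by (simp add: sum.reindex)
qed

text \<open>Some element of \<open>V\<close> is shared, and the sets through a given element
  correspond to sets of size \<open>r - 1\<close>. The factor \<open>n\<close> saved here is what
  brings the variance below the scale \<open>n ^ (2 * r)\<close>.\<close>

lemma card_meeting_subsets_le:
  assumes r: "1 \<le> r" and V: "V \<in> subsets_of_card n r"
  shows "card {V' \<in> subsets_of_card n r. V \<inter> V' \<noteq> {}} \<le> r * n ^ (r - 1)"
proof -
  have finV: "finite V" using V r unfolding subsets_of_card_def by (auto intro: finite_subset)
  have one: "card {V' \<in> subsets_of_card n r. x \<in> V'} \<le> n ^ (r - 1)" for x
  proof -
    have "card {V' \<in> subsets_of_card n r. x \<in> V'} \<le> card (subsets_of_card n (r - 1))"
    proof (rule card_inj_on_le[where f = "\<lambda>V'. V' - {x}"])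
      show "inj_on (\<lambda>V'. V' - {x}) {V' \<in> subsets_of_card n r. x \<in> V'}"
        by (auto simp: inj_on_def)
      show "(\<lambda>V'. V' - {x}) ` {V' \<in> subsets_of_card n r. x \<in> V'} \<subseteq> subsets_of_card n (r - 1)"
        by (auto simp: subsets_of_card_def)
    qed (rule finite_subsets_of_card)
    then show ?thesis using choose_le_power[of n "r - 1"] by (simp add: card_subsets_of_card)
  qed
  have "{V' \<in> subsets_of_card n r. V \<inter> V' \<noteq> {}} = (\<Union>x\<in>V. {V' \<in> subsets_of_card n r. x \<in> V'})" by auto
  then have "card {V' \<in> subsets_of_card n r. V \<inter> V' \<noteq> {}} \<le> (\<Sum>x\<in>V. card {V' \<in> subsets_of_card n r. x \<in> V'})"
    by (simp add: card_UN_le finV)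
  also have "\<dots> \<le> (\<Sum>x\<in>V. n ^ (r - 1))" by (rule sum_mono) (rule one)
  also have "\<dots> = r * n ^ (r - 1)" using V by (simp add: subsets_of_card_def)
  finally show ?thesis .
qed

context iid_weights
begin

text \<open>Only pairs of intersecting index sets contribute to the variance.\<close>

lemma elem_sym_variance:
  fixes f :: "real \<Rightarrow> real" and n r :: nat
  assumes f_meas [measurable]: "f \<in> borel_measurable borel" and f: "\<And>x. \<bar>f x\<bar> \<le> majorant x ^ 2"
    and r: "1 \<le> r"
  defines "D \<equiv> \<lambda>w. elem_sym n r (\<lambda>i. f (w i)) - real (n choose r) * (\<integral>x. f x \<partial>mu) ^ r"
  shows "integrable (weights n) (\<lambda>w. D w ^ 2)"
    and "(\<integral>w. D w ^ 2 \<partial>weights n) \<le> real r * moment4 ^ (2 * r) * real n ^ (2 * r - 1)"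
proof -
  interpret W: prob_space "weights n" by (intro prob_space_PiM prob_space_axioms)
  let ?S = "subsets_of_card n r"
  define \<mu> where "\<mu> = (\<integral>x. f x \<partial>mu)"
  define X where "X V w = (\<Prod>i\<in>V. f (w i))" for V and w :: "nat \<Rightarrow> real"
  have int_f: "integrable mu f" using f_meas f by (rule integrable_le_majorant)
  have S: "V \<subseteq> {1..n}" "finite V" "card V = r" if "V \<in> ?S" for V
    using that unfolding subsets_of_card_def by (auto intro: finite_subset)
  have D_eq: "D w ^ 2 = (\<Sum>V\<in>?S. \<Sum>V'\<in>?S. (X V w - \<mu> ^ r) * (X V' w - \<mu> ^ r))" for w
  proof -
    have "D w = (\<Sum>V\<in>?S. X V w - \<mu> ^ r)"
      by (simp add: D_def elem_sym_def X_def \<mu>_def sum_subtractf card_subsets_of_card)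
    then show ?thesis by (simp add: power2_eq_square sum_product)
  qed
  have int_X: "integrable (weights n) (X V)" and integral_X: "(\<integral>w. X V w \<partial>weights n) = \<mu> ^ r"
    if "V \<in> ?S" for V
    using integrable_prod_component[OF int_f S(1)[OF that]] integral_prod_component[OF int_f S(1)[OF that]] S(3)[OF that]
    by (simp_all add: X_def[abs_def] \<mu>_def)
  have X_meas [measurable]: "X V \<in> borel_measurable (weights n)" if "V \<in> ?S" for V
    using int_X[OF that] by simp
  have int_bound: "integrable (weights n) (\<lambda>w. \<Prod>i\<in>V \<union> V'. majorant (w i) ^ 4)"
    and integral_bound: "(\<integral>w. (\<Prod>i\<in>V \<union> V'. majorant (w i) ^ 4) \<partial>weights n) \<le> moment4 ^ (2 * r)"
    if V: "V \<in> ?S" "V' \<in> ?S" for V V'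
  proof -
    have sub: "V \<union> V' \<subseteq> {1..n}" using S(1) V by auto
    show "integrable (weights n) (\<lambda>w. \<Prod>i\<in>V \<union> V'. majorant (w i) ^ 4)"
      by (rule integrable_prod_component[OF integrable_majorant sub])
    have "card (V \<union> V') \<le> 2 * r" using card_Un_le[of V V'] S(3) V by simp
    then show "(\<integral>w. (\<Prod>i\<in>V \<union> V'. majorant (w i) ^ 4) \<partial>weights n) \<le> moment4 ^ (2 * r)"
      unfolding integral_prod_component[OF integrable_majorant sub] moment4_def[symmetric]
      by (rule power_increasing) (rule moment4_ge_1)
  qed
  have int_XX: "integrable (weights n) (\<lambda>w. X V w * X V' w)" if V: "V \<in> ?S" "V' \<in> ?S" for V V'
  proof (rule Bochner_Integration.integrable_bound[OF int_bound[OF V]])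
    show "(\<lambda>w. X V w * X V' w) \<in> borel_measurable (weights n)" using V by measurable
    show "AE w in weights n. norm (X V w * X V' w) \<le> norm (\<Prod>i\<in>V \<union> V'. majorant (w i) ^ 4)"
      using prod_mult_prod_le[OF f S(2)[OF V(1)] S(2)[OF V(2)]]
      by (intro AE_I2) (auto simp: X_def intro: order.trans[OF _ abs_ge_self])
  qed
  have expand: "(X V w - \<mu> ^ r) * (X V' w - \<mu> ^ r) = X V w * X V' w - \<mu> ^ r * X V w - \<mu> ^ r * X V' w + \<mu> ^ r * \<mu> ^ r" for V V' w
    by (simp add: algebra_simps)
  have int_cov: "integrable (weights n) (\<lambda>w. (X V w - \<mu> ^ r) * (X V' w - \<mu> ^ r))"
    if V: "V \<in> ?S" "V' \<in> ?S" for V V'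
    unfolding expand
    by (intro Bochner_Integration.integrable_add Bochner_Integration.integrable_diff integrable_mult_right
        int_XX int_X V W.integrable_const)
  have cov: "(\<integral>w. (X V w - \<mu> ^ r) * (X V' w - \<mu> ^ r) \<partial>weights n) = (\<integral>w. X V w * X V' w \<partial>weights n) - \<mu> ^ r * \<mu> ^ r"
    if V: "V \<in> ?S" "V' \<in> ?S" for V V'
  proof -
    note int = int_XX[OF V] integrable_mult_right[OF int_X[OF V(1)]] integrable_mult_right[OF int_X[OF V(2)]]
    show ?thesis
      unfolding expand
      by (subst Bochner_Integration.integral_add Bochner_Integration.integral_diff integral_mult_right_zero
          W.prob_space integral_X | intro Bochner_Integration.integrable_diff int W.integrable_const V
          | simp add: W.prob_space del: One_nat_def)+
  qed
  \<comment> \<open>Disjoint index sets are independent, so the covariance is 0; otherwise the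
    subtracted square \<open>\<mu> ^ r * \<mu> ^ r\<close> is dropped.\<close>
  have cov_le: "(\<integral>w. (X V w - \<mu> ^ r) * (X V' w - \<mu> ^ r) \<partial>weights n) \<le> (if V \<inter> V' = {} then 0 else moment4 ^ (2 * r))"
    if V: "V \<in> ?S" "V' \<in> ?S" for V V'
  proof (cases "V \<inter> V' = {}")
    case True
    have XX: "X V w * X V' w = (\<Prod>i\<in>V \<union> V'. f (w i))" for w
      unfolding X_def using True S V by (simp add: prod.union_disjoint)
    have sub: "V \<union> V' \<subseteq> {1..n}" and card: "card (V \<union> V') = r + r"
      using S V True by (auto simp: card_Un_disjoint)
    have "(\<integral>w. X V w * X V' w \<partial>weights n) = \<mu> ^ r * \<mu> ^ r"
      unfolding XX integral_prod_component[OF int_f sub] card by (simp add: \<mu>_def power_add)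
    then show ?thesis using True cov[OF V] by simp
  next
    case False
    have "(\<integral>w. X V w * X V' w \<partial>weights n) \<le> (\<integral>w. (\<Prod>i\<in>V \<union> V'. majorant (w i) ^ 4) \<partial>weights n)"
      using prod_mult_prod_le[OF f S(2)[OF V(1)] S(2)[OF V(2)]]
      by (intro integral_mono int_XX int_bound V) (auto simp: X_def intro: order.trans[OF abs_ge_self])
    also have "\<dots> \<le> moment4 ^ (2 * r)" by (rule integral_bound[OF V])
    finally have "(\<integral>w. X V w * X V' w \<partial>weights n) \<le> moment4 ^ (2 * r)" .
    moreover have "0 \<le> \<mu> ^ r * \<mu> ^ r" by (rule zero_le_square)
    ultimately show ?thesis unfolding cov[OF V] if_not_P[OF False] by linarith
  qed
  show "integrable (weights n) (\<lambda>w. D w ^ 2)"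
    unfolding D_eq using int_cov by (intro Bochner_Integration.integrable_sum) auto
  have "(\<integral>w. D w ^ 2 \<partial>weights n) = (\<Sum>V\<in>?S. \<Sum>V'\<in>?S. \<integral>w. (X V w - \<mu> ^ r) * (X V' w - \<mu> ^ r) \<partial>weights n)"
    unfolding D_eq using int_cov
    by (subst Bochner_Integration.integral_sum) (auto intro!: sum.cong Bochner_Integration.integral_sum)
  also have "\<dots> \<le> (\<Sum>V\<in>?S. \<Sum>V'\<in>?S. if V \<inter> V' = {} then 0 else moment4 ^ (2 * r))"
    by (intro sum_mono cov_le)
  also have "\<dots> = (\<Sum>V\<in>?S. real (card {V' \<in> ?S. V \<inter> V' \<noteq> {}}) * moment4 ^ (2 * r))"
    by (intro sum.cong refl) (simp add: sum.If_cases finite_subsets_of_card Int_def)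
  also have "\<dots> \<le> (\<Sum>V\<in>?S. real (r * n ^ (r - 1)) * moment4 ^ (2 * r))"
    using moment4_ge_1 by (intro sum_mono mult_right_mono of_nat_mono card_meeting_subsets_le r) auto
  also have "\<dots> = real (n choose r) * (real (r * n ^ (r - 1)) * moment4 ^ (2 * r))"
    by (simp add: card_subsets_of_card)
  also have "\<dots> \<le> real (n ^ r) * (real (r * n ^ (r - 1)) * moment4 ^ (2 * r))"
    using moment4_ge_1 by (intro mult_right_mono of_nat_mono choose_le_power) auto
  also have "\<dots> = real r * moment4 ^ (2 * r) * (real n ^ (r + (r - 1)))"
    by (simp add: power_add mult_ac)
  also have "r + (r - 1) = 2 * r - 1" using r by simp
  finally show "(\<integral>w. D w ^ 2 \<partial>weights n) \<le> real r * moment4 ^ (2 * r) * real n ^ (2 * r - 1)" .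
qed

text \<open>A bound for two overlapping cycles with joint vertex set \<open>V\<close>.
  \<open>Suc (card V)\<close> is a lower bound for the number of edges, each worth a factor
  \<open>1 / b\<close>, and no vertex has degree above 4; edges count twice if the cycles coincide.
  In the averages \<open>b\<close> is deterministic, unlike the total weight, so the expectation
  factorises.\<close>

definition cluster_weight :: "real \<Rightarrow> (nat \<Rightarrow> real) \<Rightarrow> nat set \<Rightarrow> real" where
  "cluster_weight b w V = (\<Prod>i\<in>V. majorant (w i) ^ 4) / b ^ Suc (card V)"

definition cluster_sum :: "nat \<Rightarrow> nat \<Rightarrow> real \<Rightarrow> (nat \<Rightarrow> real) \<Rightarrow> real" where
  "cluster_sum K n b w = (\<Sum>V\<in>{V. V \<subseteq> {1..n} \<and> card V \<le> K}. cluster_weight b w V)"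

lemma cluster_weight_nonneg: "0 \<le> b \<Longrightarrow> 0 \<le> cluster_weight b w V"
  by (auto simp: cluster_weight_def intro!: divide_nonneg_nonneg prod_nonneg)

lemma cluster_sum_nonneg: "0 \<le> b \<Longrightarrow> 0 \<le> cluster_sum K n b w"
  by (auto simp: cluster_sum_def intro!: sum_nonneg cluster_weight_nonneg)

text \<open>There are at most \<open>n ^ s\<close> sets of size \<open>s\<close>, against
  \<open>(c * real n) ^ Suc s\<close> in the denominator: the surplus edge is the factor
  \<open>1 / n\<close>.\<close>

lemma cluster_sum_expectation:
  assumes c: "0 < c" and n: "1 \<le> n"
  shows "integrable (weights n) (cluster_sum K n (c * real n))"
    and "(\<integral>w. cluster_sum K n (c * real n) w \<partial>weights n) \<le> (\<Sum>s\<le>K. moment4 ^ s / c ^ Suc s) / real n"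
proof -
  let ?b = "c * real n"
  let ?S = "{V. V \<subseteq> {1..n} \<and> card V \<le> K}"
  have fin: "finite ?S" by (rule finite_subset[of _ "Pow {1..n}"]) auto
  have int: "integrable (weights n) (\<lambda>w. cluster_weight ?b w V)"
    and eq: "(\<integral>w. cluster_weight ?b w V \<partial>weights n) = moment4 ^ card V / ?b ^ Suc (card V)"
    if "V \<in> ?S" for V
    using integrable_prod_component[OF integrable_majorant, of V n] integral_prod_component[OF integrable_majorant, of V n] that
    by (simp_all add: cluster_weight_def moment4_def)
  show "integrable (weights n) (cluster_sum K n ?b)"
    unfolding cluster_sum_def[abs_def] using int by (rule Bochner_Integration.integrable_sum)
  have "(\<integral>w. cluster_sum K n ?b w \<partial>weights n) = (\<Sum>V\<in>?S. moment4 ^ card V / ?b ^ Suc (card V))"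
    unfolding cluster_sum_def using int eq by (subst Bochner_Integration.integral_sum) auto
  also have "\<dots> = (\<Sum>s\<le>K. \<Sum>V\<in>{V\<in>?S. card V = s}. moment4 ^ card V / ?b ^ Suc (card V))"
    by (rule sum.group[symmetric]) (use fin in auto)
  also have "\<dots> = (\<Sum>s\<le>K. real (n choose s) * (moment4 ^ s / ?b ^ Suc s))"
  proof (rule sum.cong[OF refl])
    fix s assume "s \<in> {..K}"
    then have "{V\<in>?S. card V = s} = subsets_of_card n s" by (auto simp: subsets_of_card_def)
    moreover have "(\<Sum>V\<in>subsets_of_card n s. moment4 ^ card V / ?b ^ Suc (card V)) =
       (\<Sum>V\<in>subsets_of_card n s. moment4 ^ s / ?b ^ Suc s)"
      by (rule sum.cong) (auto simp: subsets_of_card_def)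
    ultimately show "(\<Sum>V\<in>{V\<in>?S. card V = s}. moment4 ^ card V / ?b ^ Suc (card V)) = real (n choose s) * (moment4 ^ s / ?b ^ Suc s)"
      by (simp add: card_subsets_of_card)
  qed
  also have "\<dots> \<le> (\<Sum>s\<le>K. real (n ^ s) * (moment4 ^ s / ?b ^ Suc s))"
    using moment4_ge_1 c by (intro sum_mono mult_right_mono of_nat_mono choose_le_power) auto
  also have "\<dots> = (\<Sum>s\<le>K. moment4 ^ s / c ^ Suc s) / real n"
    unfolding sum_divide_distrib using n c by (intro sum.cong) (auto simp: field_simps power_mult_distrib)
  finally show "(\<integral>w. cluster_sum K n ?b w \<partial>weights n) \<le> (\<Sum>s\<le>K. moment4 ^ s / c ^ Suc s) / real n" .
qed

end

section \<open>The conditional error for given weights\<close>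

lemma prod_one_minus_ge:
  fixes x :: "'a \<Rightarrow> real"
  assumes "finite S" "\<And>i. i \<in> S \<Longrightarrow> 0 \<le> x i \<and> x i \<le> 1"
  shows "1 - (\<Sum>i\<in>S. x i) \<le> (\<Prod>i\<in>S. 1 - x i)"
  using assms
proof (induction S)
  case (insert a S)
  have "(\<Prod>i\<in>S. 1 - x i) \<le> 1" "0 \<le> (\<Prod>i\<in>S. 1 - x i)"
    using insert.prems by (auto intro!: prod_le_1 prod_nonneg)
  then have "x a * (\<Prod>i\<in>S. 1 - x i) \<le> x a"
    using insert.prems by (intro mult_left_le) auto
  then show ?case using insert by (simp add: algebra_simps)
qed simp

lemma fact_choose_le_power: "fact k * real (n choose k) \<le> real n ^ k"
proof (cases "k \<le> n")
  case True
  have "fact n = (fact k * (n choose k)) * (fact (n - k) :: nat)"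
    using binomial_fact_lemma[OF True] by (simp add: mult_ac)
  then have "fact k * (n choose k) = fact n div (fact (n - k) :: nat)" by simp
  also have "\<dots> \<le> n ^ k" by (rule fact_div_fact_le_pow[OF True])
  finally show ?thesis by (metis of_nat_fact of_nat_le_iff of_nat_mult of_nat_power)
qed (simp add: binomial_eq_0)

text \<open>The falling factorial \<open>fact k * (n choose k)\<close> gains the factor
  \<open>n - k\<close> at each step, where the power gains \<open>n\<close>. The errors add up
  within the bound because \<open>k + k ^ 2 \<le> Suc k ^ 2\<close>.\<close>

lemma power_diff_fact_choose_le:
  "real n ^ k - fact k * real (n choose k) \<le> real k ^ 2 * real n ^ (k - 1)"
proof (induction k)
  case (Suc k)
  define a where "a = fact k * real (n choose k)"
  define c where "c = fact (Suc k) * real (n choose Suc k)"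
  have "(n - k) * (n choose k) = Suc k * (n choose Suc k)"
    by (simp only: binomial_absorb_comp binomial_absorption)
  then have "(n - k) * (fact k * (n choose k)) = fact (Suc k) * (n choose Suc k)"
    by (simp add: mult_ac del: mult_Suc mult_Suc_right)
  then have "real (n - k) * a = c"
    unfolding a_def c_def by (metis of_nat_fact of_nat_mult)
  moreover have "(real n - real k) * a \<le> real (n - k) * a"
    by (intro mult_right_mono) (auto simp: a_def)
  moreover have "real n * (real n ^ k - a) \<le> real k ^ 2 * real n ^ k"
  proof -
    have "real n * (real n ^ k - a) \<le> real n * (real k ^ 2 * real n ^ (k - 1))"
      using Suc.IH by (intro mult_left_mono) (auto simp: a_def)
    also have "\<dots> = real k ^ 2 * real n ^ k" by (cases k) auto
    finally show ?thesis .
  qed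
  moreover have "real k * a \<le> real k * real n ^ k"
    unfolding a_def by (intro mult_left_mono fact_choose_le_power) auto
  ultimately have "real n * real n ^ k - c \<le> real k * real n ^ k + real k ^ 2 * real n ^ k"
    by (simp add: algebra_simps)
  also have "\<dots> \<le> real (Suc k) ^ 2 * real n ^ k"
    by (simp add: power2_eq_square algebra_simps)
  finally show ?case by (simp add: c_def)
qed simp

text \<open>Scaling moves \<open>c / x\<close> and \<open>c / m\<close> into [0,1], where the
  \<open>k\<close>-th power has Lipschitz constant \<open>k\<close>; scaling back gives
  \<open>c ^ Suc k\<close>.\<close>

lemma inverse_power_diff_le:
  fixes x m c :: real
  assumes c: "0 < c" and x: "c \<le> x" and m: "c \<le> m"
  shows "\<bar>1 / x ^ k - 1 / m ^ k\<bar> \<le> real k * \<bar>x - m\<bar> / c ^ Suc k"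
proof -
  have eq: "1 / x ^ k - 1 / m ^ k = ((c / x) ^ k - (c / m) ^ k) / c ^ k"
    using assms by (simp add: field_simps power_divide)
  have "\<bar>(c / x) ^ k - (c / m) ^ k\<bar> \<le> real k * \<bar>c / x - c / m\<bar>"
    using norm_power_diff[of "c / x" "c / m" k] assms by simp
  moreover have "\<bar>c / x - c / m\<bar> \<le> \<bar>x - m\<bar> / c"
  proof -
    have "c / x - c / m = c * (m - x) / (x * m)" using assms by (simp add: field_simps)
    then have "\<bar>c / x - c / m\<bar> = c * \<bar>x - m\<bar> / (x * m)"
      using assms by (simp add: abs_mult abs_minus_commute)
    also have "\<dots> \<le> c * \<bar>x - m\<bar> / (c * c)"
      using assms by (intro divide_left_mono mult_mono) auto
    finally show ?thesis using c by simp
  qed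
  then have "real k * \<bar>c / x - c / m\<bar> \<le> real k * (\<bar>x - m\<bar> / c)" by (rule mult_left_mono) simp
  ultimately have "\<bar>(c / x) ^ k - (c / m) ^ k\<bar> / c ^ k \<le> real k * (\<bar>x - m\<bar> / c) / c ^ k"
    using c by (intro divide_right_mono) auto
  then have "\<bar>1 / x ^ k - 1 / m ^ k\<bar> \<le> real k * (\<bar>x - m\<bar> / c) / c ^ k"
    using c eq by simp
  also have "\<dots> = real k * \<bar>x - m\<bar> / c ^ Suc k" using c by (simp add: field_simps)
  finally show ?thesis .
qed

lemma expect_eq_subset_expect:
  "(\<Sum>G\<in>graphs n. grg_prob w n G * h (num_cycles k n G)) =
    subset_expect (edge_prob w n) (vpairs n) (\<lambda>G. h (card {C\<in>complete_cycles k n. C \<subseteq> G}))"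
  by (simp add: subset_expect_def graphs_def grg_prob_def num_cycles_def k_cycles_eq)

context
  fixes w :: "nat \<Rightarrow> real" and n :: nat
  assumes w_pos: "\<And>i. i \<in> {1..n} \<Longrightarrow> 0 < w i"
begin

lemma prod_weights_pos:
  assumes "e \<in> vpairs n"
  shows "0 < (\<Prod>i\<in>e. w i)"
  using assms w_pos by (auto simp: vpairs_def intro!: prod_pos)

lemma sum_weights_nonneg: "0 \<le> (\<Sum>i=1..n. w i)"
  using w_pos by (intro sum_nonneg) (auto simp: less_imp_le)

lemma edge_prob_range:
  assumes "e \<in> vpairs n"
  shows "0 \<le> edge_prob w n e \<and> edge_prob w n e \<le> 1"
  using prod_weights_pos[OF assms] sum_weights_nonneg by (simp add: edge_prob_def Let_def)

lemma abs_expect_le: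
  assumes "\<And>m. \<bar>h m\<bar> \<le> 1"
  shows "\<bar>\<Sum>G\<in>graphs n. grg_prob w n G * h (num_cycles k n G)\<bar> \<le> 1"
proof -
  have "\<bar>subset_expect (edge_prob w n) (vpairs n) F\<bar> \<le> 1" if "\<And>G. \<bar>F G\<bar> \<le> 1" for F
  proof -
    have "\<bar>subset_expect (edge_prob w n) (vpairs n) F\<bar> \<le> subset_expect (edge_prob w n) (vpairs n) (\<lambda>G. \<bar>F G\<bar>)"
      by (rule subset_expect_abs_le) (rule edge_prob_range)
    also have "\<dots> \<le> subset_expect (edge_prob w n) (vpairs n) (\<lambda>_. 1)"
      by (rule subset_expect_mono) (auto simp: edge_prob_range that)
    finally show ?thesis by (simp add: subset_expect_const finite_vpairs)
  qed
  then show ?thesis unfolding expect_eq_subset_expect using assms by simp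
qed

end

text \<open>A cycle with vertices in \<open>V\<close> is one of the \<open>2 ^ 2 ^ card V\<close> families of subsets of \<open>V\<close>.\<close>

definition pair_bound :: "nat \<Rightarrow> real" where
  "pair_bound k = 2 ^ (2 ^ (2 * k)) * 2 ^ (2 ^ (2 * k))"

text \<open>A fixed weight vector whose total is at least \<open>b\<close>, later half the expected
  total. The condition \<open>1 \<le> b\<close> allows surplus factors \<open>1 / b\<close> to be
  discarded.\<close>

locale heavy_weights = iid_weights +
  fixes w :: "nat \<Rightarrow> real" and n k :: nat and b :: real
  assumes k: "3 \<le> k" and w_pos: "\<And>i. i \<in> {1..n} \<Longrightarrow> 0 < w i"
    and b: "1 \<le> b" "b \<le> (\<Sum>i=1..n. w i)"
begin

abbreviation "L \<equiv> \<Sum>i=1..n. w i"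
abbreviation "p \<equiv> edge_prob w n"
abbreviation "\<Gamma> \<equiv> complete_cycles k n"
abbreviation "\<tau> \<equiv> cluster_weight b w"

lemma L_pos: "0 < L" using b by linarith

lemma edge_pos: "e \<in> vpairs n \<Longrightarrow> 0 < (\<Prod>i\<in>e. w i)"
  by (intro prod_weights_pos w_pos)

lemma edge_range: "e \<in> vpairs n \<Longrightarrow> 0 \<le> p e \<and> p e \<le> 1"
  by (intro edge_prob_range w_pos)

lemma majorant_prod_ge_1: "1 \<le> (\<Prod>i\<in>e. majorant (w i))"
  by (intro prod_ge_1 majorant_ge_1)

lemma \<Gamma>E:
  assumes "C \<in> \<Gamma>"
  obtains v where "inj_on v {..<k}" "C = cycle_edges k v"
  using assms by (auto simp: complete_cycles_def)

lemma \<Gamma>_props: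
  assumes C: "C \<in> \<Gamma>"
  shows "C \<subseteq> vpairs n" "finite C" "card C = k" "C \<noteq> {}" "\<Union>C \<subseteq> {1..n}" "finite (\<Union>C)" "card (\<Union>C) = k"
    "(\<Prod>e\<in>C. \<Prod>x\<in>e. q x) = (\<Prod>x\<in>\<Union>C. (q x :: real) ^ 2)"
proof -
  obtain v where v: "inj_on v {..<k}" "C = cycle_edges k v" using C by (rule \<Gamma>E)
  show sub: "C \<subseteq> vpairs n" using complete_cycles_subset[OF _ C] k by simp
  show "finite C" using sub finite_vpairs finite_subset by blast
  show card: "card C = k" using card_cycle_edges[OF k v(1)] v(2) by simp
  show "C \<noteq> {}" using card k by auto
  show "\<Union>C \<subseteq> {1..n}" using sub by (auto simp: vpairs_def)
  then show "finite (\<Union>C)" by (rule finite_subset) simp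
  show "card (\<Union>C) = k" using v k by (simp add: Union_cycle_edges card_image)
  show "(\<Prod>e\<in>C. \<Prod>x\<in>e. q x) = (\<Prod>x\<in>\<Union>C. (q x :: real) ^ 2)"
    unfolding v(2) by (rule prod_cycle_edges[OF k v(1)])
qed

lemma edge_weight_le:
  assumes "e \<in> vpairs n"
  shows "(\<Prod>i\<in>e. w i) \<le> (\<Prod>i\<in>e. majorant (w i))"
proof -
  have "0 \<le> w i" if "i \<in> e" for i using that assms w_pos by (auto simp: vpairs_def less_imp_le)
  then show ?thesis
    using abs_le_majorant by (intro prod_mono) (auto intro: order.trans[OF abs_ge_self])
qed

lemma edge_prob_le:
  assumes "e \<in> vpairs n"
  shows "p e \<le> (\<Prod>i\<in>e. w i) / L" "p e \<le> (\<Prod>i\<in>e. majorant (w i)) / b"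
proof -
  note q = edge_pos[OF assms]
  show 1: "p e \<le> (\<Prod>i\<in>e. w i) / L"
    unfolding edge_prob_def Let_def using q L_pos by (intro divide_left_mono) auto
  also have "\<dots> \<le> (\<Prod>i\<in>e. majorant (w i)) / b"
    using q edge_weight_le[OF assms] b by (intro frac_le) (auto intro: less_imp_le)
  finally show "p e \<le> (\<Prod>i\<in>e. majorant (w i)) / b" .
qed

lemma prod_edge_prob_le:
  assumes "S \<subseteq> vpairs n"
  shows "(\<Prod>e\<in>S. p e) \<le> (\<Prod>e\<in>S. \<Prod>i\<in>e. majorant (w i)) / b ^ card S"
proof -
  have "(\<Prod>e\<in>S. p e) \<le> (\<Prod>e\<in>S. (\<Prod>i\<in>e. majorant (w i)) / b)"
    using assms edge_range edge_prob_le(2) by (intro prod_mono) auto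
  then show ?thesis by (simp add: prod_dividef)
qed

lemma prod_majorant_mult_le:
  assumes A: "A \<in> \<Gamma>" and B: "B \<in> \<Gamma>"
  shows "(\<Prod>x\<in>\<Union>A. majorant (w x) ^ 2) * (\<Prod>x\<in>\<Union>B. majorant (w x) ^ 2) \<le> (\<Prod>x\<in>\<Union>A \<union> \<Union>B. majorant (w x) ^ 4)"
  using prod_mult_prod_le[of "\<lambda>x. majorant x ^ 2" "\<Union>A" "\<Union>B" w] \<Gamma>_props(6)[OF A] \<Gamma>_props(6)[OF B]
  by (simp add: abs_le_iff)

text \<open>Each edge yields a factor \<open>1 / b\<close>. For distinct cycles the edges of the
  union outnumber its vertices; for equal ones there are \<open>k + k \<ge> Suc k\<close> factors.
  In the numerator \<open>B - A\<close> is padded to \<open>B\<close>, so that each cycle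
  contributes a square at each of its vertices.\<close>

lemma overlap_weight_le:
  assumes A: "A \<in> \<Gamma>" and B: "B \<in> \<Gamma>" and AB: "A \<inter> B \<noteq> {} \<or> A = B"
  shows "overlap_weight p A B \<le> \<tau> (\<Union>A \<union> \<Union>B)"
proof -
  let ?q = "\<lambda>e. \<Prod>i\<in>e. majorant (w i)" and ?V = "\<Union>A \<union> \<Union>B"
  note A' = \<Gamma>_props[OF A] and B' = \<Gamma>_props[OF B]
  have nonneg: "0 \<le> (\<Prod>x\<in>?V. majorant (w x) ^ 4)" by (auto intro: prod_nonneg)
  show ?thesis
  proof (cases "A = B")
    case True
    have p_nonneg: "0 \<le> (\<Prod>e\<in>A. p e)" using A'(1) edge_range by (intro prod_nonneg) auto
    have "overlap_weight p A B = (\<Prod>e\<in>A. p e) * (\<Prod>e\<in>A. p e)"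
      using True by (simp add: overlap_weight_def)
    also have "\<dots> \<le> (\<Prod>e\<in>A. ?q e) / b ^ card A * ((\<Prod>e\<in>A. ?q e) / b ^ card A)"
      using p_nonneg order.trans[OF p_nonneg prod_edge_prob_le[OF A'(1)]] prod_edge_prob_le[OF A'(1)]
      by (intro mult_mono)
    also have "\<dots> = (\<Prod>x\<in>\<Union>A. majorant (w x) ^ 2) * (\<Prod>x\<in>\<Union>B. majorant (w x) ^ 2) / b ^ (k + k)"
      using True A' by (simp add: power_add)
    also have "\<dots> \<le> (\<Prod>x\<in>?V. majorant (w x) ^ 4) / b ^ Suc (card ?V)"
      using nonneg b k True A'(7) prod_majorant_mult_le[OF A B]
      by (intro frac_le power_increasing) auto
    finally show ?thesis by (simp add: cluster_weight_def)
  next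
    case False
    obtain a where a: "inj_on a {..<k}" "A = cycle_edges k a" using A by (rule \<Gamma>E)
    obtain b' where b': "inj_on b' {..<k}" "B = cycle_edges k b'" using B by (rule \<Gamma>E)
    have card: "card ?V < card (A \<union> B)"
      using card_Un_cycle_edges[OF k a(1) b'(1)] a b' False AB by simp
    have "overlap_weight p A B = (\<Prod>e\<in>A \<union> (B - A). p e)"
      unfolding overlap_weight_def using False A' B' by (subst prod.union_disjoint) auto
    also have "\<dots> \<le> (\<Prod>e\<in>A \<union> (B - A). ?q e) / b ^ card (A \<union> (B - A))"
      using A' B' by (intro prod_edge_prob_le) auto
    also have "\<dots> = (\<Prod>e\<in>A. ?q e) * (\<Prod>e\<in>B - A. ?q e) / b ^ card (A \<union> B)"
      using A' B' by (subst prod.union_disjoint) auto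
    also have "\<dots> \<le> (\<Prod>e\<in>A. ?q e) * (\<Prod>e\<in>B. ?q e) / b ^ card (A \<union> B)"
    proof (intro divide_right_mono mult_left_mono)
      show "(\<Prod>e\<in>B - A. ?q e) \<le> (\<Prod>e\<in>B. ?q e)"
        using B' majorant_prod_ge_1 by (intro prod_mono2) (auto intro: order.trans[OF zero_le_one majorant_prod_ge_1])
    qed (use b in \<open>auto intro!: prod_nonneg intro: order.trans[OF zero_le_one majorant_ge_1]\<close>)
    also have "\<dots> \<le> (\<Prod>x\<in>?V. majorant (w x) ^ 4) / b ^ Suc (card ?V)"
      using nonneg b card A' B' prod_majorant_mult_le[OF A B]
      by (intro frac_le power_increasing) auto
    finally show ?thesis by (simp add: cluster_weight_def)
  qed
qed

text \<open>Pairs are grouped by their joint vertex set. A set of at most \<open>2 * k\<close>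
  vertices carries a number of pairs bounded independently of \<open>n\<close>, and a crude bound
  suffices for the rate.\<close>

lemma pair_sum_le:
  "(\<Sum>A\<in>\<Gamma>. \<Sum>B\<in>{B\<in>\<Gamma>. A \<inter> B \<noteq> {} \<or> A = B}. \<tau> (\<Union>A \<union> \<Union>B)) \<le> pair_bound k * cluster_sum (2 * k) n b w"
proof -
  let ?S = "{V. V \<subseteq> {1..n} \<and> card V \<le> 2 * k}"
  let ?P = "Sigma \<Gamma> (\<lambda>A. {B\<in>\<Gamma>. A \<inter> B \<noteq> {} \<or> A = B})"
  let ?U = "\<lambda>(A, B). \<Union>A \<union> \<Union>B :: nat set"
  have fin\<Gamma>: "finite \<Gamma>" using k by (intro finite_complete_cycles) simp
  have finS: "finite ?S" by (rule finite_subset[of _ "Pow {1..n}"]) auto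
  have finP: "finite ?P" using fin\<Gamma> by (intro finite_SigmaI) auto
  have "(\<Sum>A\<in>\<Gamma>. \<Sum>B\<in>{B\<in>\<Gamma>. A \<inter> B \<noteq> {} \<or> A = B}. \<tau> (\<Union>A \<union> \<Union>B)) = (\<Sum>x\<in>?P. \<tau> (?U x))"
    using fin\<Gamma> by (subst sum.Sigma) (auto simp: case_prod_unfold)
  also have "\<dots> = (\<Sum>V\<in>?S. \<Sum>x\<in>{x\<in>?P. ?U x = V}. \<tau> (?U x))"
  proof (rule sum.group[symmetric, OF finP finS])
    show "?U ` ?P \<subseteq> ?S"
    proof (rule image_subsetI)
      fix x assume "x \<in> ?P"
      then obtain A B where x: "x = (A, B)" and AB: "A \<in> \<Gamma>" "B \<in> \<Gamma>" by auto
      show "?U x \<in> ?S"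
        using \<Gamma>_props(5,7)[OF AB(1)] \<Gamma>_props(5,7)[OF AB(2)] card_Un_le[of "\<Union>A" "\<Union>B"] by (simp add: x)
    qed
  qed
  also have "\<dots> \<le> (\<Sum>V\<in>?S. pair_bound k * \<tau> V)"
  proof (rule sum_mono)
    fix V assume V: "V \<in> ?S"
    then have finV: "finite V" by (auto intro: finite_subset)
    have "{x\<in>?P. ?U x = V} \<subseteq> Pow (Pow V) \<times> Pow (Pow V)" by auto
    then have "card {x\<in>?P. ?U x = V} \<le> card (Pow (Pow V) \<times> Pow (Pow V))"
      using finV by (intro card_mono) auto
    also have "\<dots> = 2 ^ (2 ^ card V) * 2 ^ (2 ^ card V)"
      using finV by (simp add: card_cartesian_product card_Pow)
    also have "\<dots> \<le> 2 ^ (2 ^ (2 * k)) * 2 ^ (2 ^ (2 * k))"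
      using V by (intro mult_mono power_increasing) auto
    finally have "real (card {x\<in>?P. ?U x = V}) \<le> real (2 ^ (2 ^ (2 * k)) * 2 ^ (2 ^ (2 * k)))" by (rule of_nat_mono)
    then have card: "real (card {x\<in>?P. ?U x = V}) \<le> pair_bound k" by (simp add: pair_bound_def)
    have "(\<Sum>x\<in>{x\<in>?P. ?U x = V}. \<tau> (?U x)) = (\<Sum>x\<in>{x\<in>?P. ?U x = V}. \<tau> V)"
      by (rule sum.cong) auto
    also have "\<dots> = real (card {x\<in>?P. ?U x = V}) * \<tau> V" by simp
    also have "\<dots> \<le> pair_bound k * \<tau> V"
      using card b by (intro mult_right_mono cluster_weight_nonneg) auto
    finally show "(\<Sum>x\<in>{x\<in>?P. ?U x = V}. \<tau> (?U x)) \<le> pair_bound k * \<tau> V" .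
  qed
  finally show ?thesis by (simp add: cluster_sum_def sum_distrib_left)
qed

lemma overlap_sum_le:
  "(\<Sum>A\<in>\<Gamma>. \<Sum>B\<in>{B\<in>\<Gamma>. A \<inter> B \<noteq> {} \<or> A = B}. overlap_weight p A B) \<le> pair_bound k * cluster_sum (2 * k) n b w"
  by (rule order.trans[OF _ pair_sum_le]) (intro sum_mono overlap_weight_le, auto)

text \<open>The diagonal pairs \<open>(A, A)\<close> already contribute this sum to the sum over all
  pairs.\<close>

lemma cycle_cluster_sum_le: "(\<Sum>A\<in>\<Gamma>. \<tau> (\<Union>A)) \<le> pair_bound k * cluster_sum (2 * k) n b w"
proof (rule order.trans[OF _ pair_sum_le], rule sum_mono)
  fix A assume A: "A \<in> \<Gamma>"
  have fin\<Gamma>: "finite \<Gamma>" using k by (intro finite_complete_cycles) simp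
  have "\<tau> (\<Union>A \<union> \<Union>A) \<le> (\<Sum>B\<in>{B\<in>\<Gamma>. A \<inter> B \<noteq> {} \<or> A = B}. \<tau> (\<Union>A \<union> \<Union>B))"
    by (rule member_le_sum) (use A fin\<Gamma> b in \<open>auto intro: cluster_weight_nonneg\<close>)
  then show "\<tau> (\<Union>A) \<le> (\<Sum>B\<in>{B\<in>\<Gamma>. A \<inter> B \<noteq> {} \<or> A = B}. \<tau> (\<Union>A \<union> \<Union>B))" by simp
qed

text \<open>From \<open>p = q / (L + q)\<close> follows \<open>p = q / L * (1 - p)\<close>, so the
  product of the \<open>p e\<close> is the ideal product \<open>Q\<close> times the product of the
  \<open>1 - p e\<close>. The relative error is then at most the sum of the \<open>p e\<close>, and
  each of these supplies the extra factor \<open>1 / b\<close> of a cluster weight.\<close>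

lemma cycle_prob_approx:
  assumes C: "C \<in> \<Gamma>"
  shows "\<bar>(\<Prod>x\<in>\<Union>C. w x ^ 2) / L ^ k - (\<Prod>e\<in>C. p e)\<bar> \<le> real k * \<tau> (\<Union>C)"
proof -
  let ?q = "\<lambda>e. \<Prod>i\<in>e. w i"
  note C' = \<Gamma>_props[OF C]
  have q: "0 < ?q e" if "e \<in> C" for e using edge_pos that C' by auto
  have w0: "0 \<le> w x" if "x \<in> \<Union>C" for x using w_pos[of x] that C'(5) by (meson less_imp_le subsetD)
  define Q where "Q = (\<Prod>x\<in>\<Union>C. w x ^ 2) / L ^ k"
  have Q: "Q = (\<Prod>e\<in>C. ?q e / L)"
    unfolding Q_def C'(8)[symmetric] by (simp add: prod_dividef C'(3))
  have Q_nonneg: "0 \<le> Q" unfolding Q_def using L_pos by (auto intro!: divide_nonneg_nonneg prod_nonneg)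
  have pq: "p e = ?q e / L * (1 - p e)" if "e \<in> C" for e
    using q[OF that] L_pos by (simp add: edge_prob_def Let_def field_simps)
  have "(\<Prod>e\<in>C. p e) = Q * (\<Prod>e\<in>C. 1 - p e)"
    unfolding Q prod.distrib[symmetric] by (rule prod.cong[OF refl]) (rule pq)
  moreover have p01: "0 \<le> p e \<and> p e \<le> 1" if "e \<in> C" for e
    using edge_range that C' by auto
  have "(\<Prod>e\<in>C. 1 - p e) \<le> 1" using p01 by (intro prod_le_1) auto
  moreover have "1 - (\<Sum>e\<in>C. p e) \<le> (\<Prod>e\<in>C. 1 - p e)"
    using C' p01 by (intro prod_one_minus_ge) auto
  ultimately have le: "0 \<le> Q - (\<Prod>e\<in>C. p e)" "Q - (\<Prod>e\<in>C. p e) \<le> Q * (\<Sum>e\<in>C. p e)"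
    using Q_nonneg mult_left_mono[of "1 - (\<Sum>e\<in>C. p e)" "\<Prod>e\<in>C. 1 - p e" Q] mult_left_le[of "\<Prod>e\<in>C. 1 - p e" Q]
    by (auto simp: algebra_simps)
  let ?M = "\<Prod>x\<in>\<Union>C. majorant (w x) ^ 2"
  have M_nonneg: "0 \<le> ?M" by (auto intro: prod_nonneg)
  have Q_le: "Q \<le> ?M / b ^ k"
    unfolding Q_def
  proof (intro frac_le power_mono prod_mono)
    fix x assume "x \<in> \<Union>C"
    then show "0 \<le> w x ^ 2 \<and> w x ^ 2 \<le> majorant (w x) ^ 2"
      using w0[of x] abs_le_majorant[of "w x"] by (auto intro!: power_mono)
  qed (use b M_nonneg in auto)
  \<comment> \<open>The weight of one edge is padded to the product of squares over the whole cycle,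
    so that multiplying by the bound for \<open>Q\<close> produces fourth powers at every
    vertex.\<close>
  have sum_le: "(\<Sum>e\<in>C. p e) \<le> real k * (?M / b)"
  proof -
    have "(\<Sum>e\<in>C. p e) \<le> (\<Sum>e\<in>C. ?M / b)"
    proof (rule sum_mono)
      fix e assume e: "e \<in> C"
      have "p e \<le> (\<Prod>i\<in>e. majorant (w i)) / b" using edge_prob_le(2) e C' by auto
      also have "(\<Prod>i\<in>e. majorant (w i)) = (\<Prod>e\<in>{e}. \<Prod>i\<in>e. majorant (w i))" by simp
      also have "\<dots> \<le> (\<Prod>e\<in>C. \<Prod>i\<in>e. majorant (w i))"
        using C' e majorant_prod_ge_1 by (intro prod_mono2) (auto intro: order.trans[OF zero_le_one majorant_prod_ge_1])
      also have "\<dots> = ?M" by (rule C'(8))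
      finally show "p e \<le> ?M / b" using b by (simp add: divide_right_mono)
    qed
    then show ?thesis by (simp add: C'(3))
  qed
  have "Q - (\<Prod>e\<in>C. p e) \<le> Q * (\<Sum>e\<in>C. p e)" by (rule le(2))
  also have "\<dots> \<le> ?M / b ^ k * (real k * (?M / b))"
    using Q_nonneg Q_le sum_le p01 M_nonneg b by (intro mult_mono) (auto intro: sum_nonneg)
  also have "\<dots> = real k * (?M * ?M / b ^ Suc k)" by (simp add: field_simps)
  also have "?M * ?M = (\<Prod>x\<in>\<Union>C. majorant (w x) ^ 4)"
    by (simp add: prod.distrib[symmetric] power_add[symmetric])
  finally show ?thesis using le(1) by (simp add: Q_def cluster_weight_def C'(7))
qed

lemma cycle_square_sum:
  "(\<Sum>C\<in>\<Gamma>. \<Prod>x\<in>\<Union>C. w x ^ 2) = fact k / (2 * real k) * elem_sym n k (\<lambda>i. w i ^ 2)"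
proof -
  have fin\<Gamma>: "finite \<Gamma>" using k by (intro finite_complete_cycles) simp
  have "(\<Sum>C\<in>\<Gamma>. \<Prod>x\<in>\<Union>C. w x ^ 2) =
     (\<Sum>V\<in>subsets_of_card n k. \<Sum>C\<in>{C\<in>\<Gamma>. \<Union>C = V}. \<Prod>x\<in>\<Union>C. w x ^ 2)"
    by (rule sum.group[symmetric, OF fin\<Gamma> finite_subsets_of_card])
      (use \<Gamma>_props(5,7) in \<open>auto simp: subsets_of_card_def\<close>)
  also have "\<dots> = (\<Sum>V\<in>subsets_of_card n k. fact k / (2 * real k) * (\<Prod>x\<in>V. w x ^ 2))"
  proof (rule sum.cong[OF refl])
    fix V assume V: "V \<in> subsets_of_card n k"
    have "2 * k * card {C\<in>\<Gamma>. \<Union>C = V} = fact k"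
      using V by (intro card_complete_cycles_on k) (auto simp: subsets_of_card_def)
    then have "2 * real k * real (card {C\<in>\<Gamma>. \<Union>C = V}) = fact k"
      by (metis of_nat_fact of_nat_mult of_nat_numeral)
    then have "real (card {C\<in>\<Gamma>. \<Union>C = V}) = fact k / (2 * real k)"
      using k by (simp add: field_simps)
    moreover have "(\<Sum>C\<in>{C\<in>\<Gamma>. \<Union>C = V}. \<Prod>x\<in>\<Union>C. w x ^ 2) = (\<Sum>C\<in>{C\<in>\<Gamma>. \<Union>C = V}. \<Prod>x\<in>V. w x ^ 2)"
      by (rule sum.cong) auto
    ultimately show "(\<Sum>C\<in>{C\<in>\<Gamma>. \<Union>C = V}. \<Prod>x\<in>\<Union>C. w x ^ 2) = fact k / (2 * real k) * (\<Prod>x\<in>V. w x ^ 2)"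
      by simp
  qed
  finally show ?thesis by (simp add: elem_sym_def sum_distrib_left)
qed

text \<open>In the factor \<open>real k + 2\<close>, the \<open>real k\<close> comes from replacing
  edge probabilities by \<open>q / L\<close>, the 2 from the overlap term of the Poisson
  approximation.\<close>

lemma poisson_approx_weights:
  fixes h :: "nat \<Rightarrow> real"
  assumes h: "\<And>m. \<bar>h m\<bar> \<le> 1" and lam: "0 < lam"
  shows "\<bar>(\<Sum>G\<in>graphs n. grg_prob w n G * h (num_cycles k n G)) - measure_pmf.expectation (poisson_pmf lam) h\<bar>
    \<le> 2 * exp lam * (\<bar>lam - fact k / (2 * real k) * elem_sym n k (\<lambda>i. w i ^ 2) / L ^ k\<bar> +
        (real k + 2) * pair_bound k * cluster_sum (2 * k) n b w)"
proof -
  have fin\<Gamma>: "finite \<Gamma>" using k by (intro finite_complete_cycles) simp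
  let ?T = "cluster_sum (2 * k) n b w" and ?\<Lambda> = "fact k / (2 * real k) * elem_sym n k (\<lambda>i. w i ^ 2) / L ^ k"
  have "\<bar>?\<Lambda> - (\<Sum>C\<in>\<Gamma>. \<Prod>e\<in>C. p e)\<bar> = \<bar>\<Sum>C\<in>\<Gamma>. (\<Prod>x\<in>\<Union>C. w x ^ 2) / L ^ k - (\<Prod>e\<in>C. p e)\<bar>"
    by (simp only: cycle_square_sum[symmetric] sum_subtractf sum_divide_distrib)
  also have "\<dots> \<le> (\<Sum>C\<in>\<Gamma>. real k * \<tau> (\<Union>C))"
    by (intro order.trans[OF sum_abs] sum_mono cycle_prob_approx)
  also have "\<dots> \<le> real k * (pair_bound k * ?T)"
    unfolding sum_distrib_left[symmetric] by (intro mult_left_mono cycle_cluster_sum_le) auto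
  finally have "\<bar>lam - (\<Sum>C\<in>\<Gamma>. \<Prod>e\<in>C. p e)\<bar> \<le> \<bar>lam - ?\<Lambda>\<bar> + real k * (pair_bound k * ?T)" by linarith
  then have "\<bar>lam - (\<Sum>C\<in>\<Gamma>. \<Prod>e\<in>C. p e)\<bar> +
      2 * (\<Sum>A\<in>\<Gamma>. \<Sum>B\<in>{B\<in>\<Gamma>. A \<inter> B \<noteq> {} \<or> A = B}. overlap_weight p A B)
      \<le> \<bar>lam - ?\<Lambda>\<bar> + (real k + 2) * pair_bound k * ?T"
    using overlap_sum_le by (simp add: algebra_simps)
  then have "2 * exp lam * (\<bar>lam - (\<Sum>C\<in>\<Gamma>. \<Prod>e\<in>C. p e)\<bar> +
      2 * (\<Sum>A\<in>\<Gamma>. \<Sum>B\<in>{B\<in>\<Gamma>. A \<inter> B \<noteq> {} \<or> A = B}. overlap_weight p A B))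
      \<le> 2 * exp lam * (\<bar>lam - ?\<Lambda>\<bar> + (real k + 2) * pair_bound k * ?T)"
    by (intro mult_left_mono) auto
  moreover have "\<bar>subset_expect p (vpairs n) (\<lambda>G. h (card {A\<in>\<Gamma>. A \<subseteq> G})) - measure_pmf.expectation (poisson_pmf lam) h\<bar>
    \<le> 2 * exp lam * (\<bar>lam - (\<Sum>C\<in>\<Gamma>. \<Prod>e\<in>C. p e)\<bar> +
      2 * (\<Sum>A\<in>\<Gamma>. \<Sum>B\<in>{B\<in>\<Gamma>. A \<inter> B \<noteq> {} \<or> A = B}. overlap_weight p A B))"
    by (rule poisson_approx_random_subset)
      (use edge_range \<Gamma>_props(1) fin\<Gamma> h lam finite_vpairs in auto)
  ultimately show ?thesis unfolding expect_eq_subset_expect by linarith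
qed

end

text \<open>Three replacements, one for each term on the right: the symmetric polynomial
  \<open>e\<close> by its mean, the falling factorial by \<open>real n ^ k\<close>, and
  \<open>L / real n\<close> by \<open>m\<close>.\<close>

lemma elem_sym_ratio_diff:
  fixes e L M m c :: real
  assumes c: "0 < c" "c \<le> m" and n: "1 \<le> n" and L: "c * real n \<le> L" and M: "0 \<le> M"
  shows "\<bar>fact k * e / L ^ k - (M / m) ^ k\<bar> \<le>
    fact k / c ^ k * \<bar>(e - real (n choose k) * M ^ k) / real n ^ k\<bar> +
    M ^ k * real k ^ 2 / c ^ k / real n + M ^ k * real k / c ^ Suc k * \<bar>L / real n - m\<bar>"
proof -
  define B where "B = real (n choose k)"
  have cn: "0 < c * real n" using c n by simp
  then have L_pos: "0 < L" using L by linarith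
  have Lk: "c ^ k * real n ^ k \<le> L ^ k"
    unfolding power_mult_distrib[symmetric] using cn L by (intro power_mono) auto
  have abs_triangle: "\<bar>x - y + z\<bar> \<le> \<bar>x\<bar> + \<bar>y\<bar> + \<bar>z\<bar>" for x y z :: real by linarith
  have "fact k * e / L ^ k - (M / m) ^ k = fact k * (e - B * M ^ k) / L ^ k -
      M ^ k * (real n ^ k - fact k * B) / L ^ k + M ^ k * (real n ^ k / L ^ k - 1 / m ^ k)"
    by (simp add: power_divide diff_divide_distrib algebra_simps)
  then have "\<bar>fact k * e / L ^ k - (M / m) ^ k\<bar> \<le> \<bar>fact k * (e - B * M ^ k) / L ^ k\<bar> +
      \<bar>M ^ k * (real n ^ k - fact k * B) / L ^ k\<bar> + \<bar>M ^ k * (real n ^ k / L ^ k - 1 / m ^ k)\<bar>"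
    by (simp only: abs_triangle)
  also have "\<bar>fact k * (e - B * M ^ k) / L ^ k\<bar> \<le> fact k / c ^ k * \<bar>(e - B * M ^ k) / real n ^ k\<bar>"
  proof -
    have "\<bar>fact k * (e - B * M ^ k) / L ^ k\<bar> = fact k * \<bar>e - B * M ^ k\<bar> / L ^ k"
      using L_pos by (simp add: abs_mult)
    also have "\<dots> \<le> fact k * \<bar>e - B * M ^ k\<bar> / (c ^ k * real n ^ k)"
      using Lk c n L_pos by (intro divide_left_mono) auto
    finally show ?thesis by (simp add: abs_mult)
  qed
  also have "\<bar>M ^ k * (real n ^ k - fact k * B) / L ^ k\<bar> \<le> M ^ k * real k ^ 2 / c ^ k / real n"
  proof (cases "k = 0")
    case False
    have "0 \<le> real n ^ k - fact k * B" "real n ^ k - fact k * B \<le> real k ^ 2 * real n ^ (k - 1)"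
      using fact_choose_le_power[of k n] power_diff_fact_choose_le[of n k] by (auto simp: B_def)
    then have "\<bar>M ^ k * (real n ^ k - fact k * B) / L ^ k\<bar> \<le> M ^ k * (real k ^ 2 * real n ^ (k - 1)) / (c ^ k * real n ^ k)"
      unfolding abs_divide abs_mult using Lk c n L_pos M
      by (intro frac_le mult_mono) (auto simp del: One_nat_def)
    also have "\<dots> = M ^ k * real k ^ 2 / c ^ k / real n"
    proof -
      have "real n ^ k = real n * real n ^ (k - 1)" using False by (metis power_eq_if)
      then show ?thesis using n c by simp
    qed
    finally show ?thesis .
  qed (simp add: B_def)
  also have "\<bar>M ^ k * (real n ^ k / L ^ k - 1 / m ^ k)\<bar> \<le> M ^ k * real k / c ^ Suc k * \<bar>L / real n - m\<bar>"
  proof -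
    have "real n ^ k / L ^ k = 1 / (L / real n) ^ k" using n by (simp add: power_divide)
    moreover have "c \<le> L / real n" using L n by (simp add: field_simps)
    ultimately have "\<bar>real n ^ k / L ^ k - 1 / m ^ k\<bar> \<le> real k * \<bar>L / real n - m\<bar> / c ^ Suc k"
      using inverse_power_diff_le[of c "L / real n" m k] c by simp
    then have "M ^ k * \<bar>real n ^ k / L ^ k - 1 / m ^ k\<bar> \<le> M ^ k * (real k * \<bar>L / real n - m\<bar> / c ^ Suc k)"
      using M by (intro mult_left_mono) auto
    then show ?thesis using M by (simp add: abs_mult)
  qed
  finally show ?thesis by (simp add: B_def)
qed

text \<open>A pointwise counterpart of the Cauchy-Schwarz bound: if \<open>x ^ 2\<close> has mean of
  order \<open>1 / n\<close>, the choice \<open>t = 1 / sqrt n\<close> gives order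
  \<open>1 / sqrt n\<close>, with only squares to integrate.\<close>

lemma abs_le_scaled_square:
  fixes x t :: real
  assumes "0 < t"
  shows "\<bar>x\<bar> \<le> t + x ^ 2 / t"
proof -
  have "0 \<le> (\<bar>x\<bar> - t) ^ 2" "0 \<le> \<bar>x\<bar> * t" using assms by auto
  then have "\<bar>x\<bar> * t \<le> t ^ 2 + x ^ 2" unfolding power2_diff power2_abs by linarith
  then show ?thesis using assms by (simp add: field_simps power2_eq_square)
qed

section \<open>Averaging over the weights\<close>

context iid_weights
begin

lemma measurable_weight: "i \<in> {1..n} \<Longrightarrow> (\<lambda>w. w i) \<in> borel_measurable (weights n)"
  using measurable_component_singleton[of i "{1..n}" "\<lambda>_. mu"] measurable_cong_sets[OF refl sets_mu] by blast

lemma measurable_conditional_expectation: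
  "(\<lambda>w. \<Sum>G\<in>graphs n. grg_prob w n G * h (num_cycles k n G)) \<in> borel_measurable (weights n)"
proof -
  have "(\<lambda>w. edge_prob w n e) \<in> borel_measurable (weights n)" if "e \<in> vpairs n" for e
  proof -
    have "(\<lambda>w. \<Prod>i\<in>e. w i) \<in> borel_measurable (weights n)"
      using that by (intro borel_measurable_prod measurable_weight) (auto simp: vpairs_def)
    moreover have "(\<lambda>w. \<Sum>i=1..n. w i) \<in> borel_measurable (weights n)"
      by (intro borel_measurable_sum measurable_weight)
    ultimately show ?thesis
      unfolding edge_prob_def Let_def by (intro borel_measurable_divide borel_measurable_add)
  qed
  then show ?thesis
    unfolding grg_prob_def
    by (intro borel_measurable_sum borel_measurable_times borel_measurable_const borel_measurable_prod) auto
qed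

lemma AE_weights_pos:
  assumes "AE x in mu. x > 0"
  shows "AE w in weights n. \<forall>i\<in>{1..n}. 0 < w i"
  by (intro AE_finite_allI AE_PiM_component prob_space_axioms assms) auto

lemma abs_le_majorant_sq: "\<bar>x\<bar> \<le> majorant x ^ 2"
  using majorant_ge_1[of x] by (intro order.trans[OF abs_le_majorant] self_le_power) auto

lemma mean_pos:
  assumes pos: "AE x in mu. x > 0"
  shows "0 < (\<integral>x. x \<partial>mu)"
proof -
  have int: "integrable mu (\<lambda>x. x)"
    by (auto intro!: integrable_le_majorant abs_le_majorant_sq)
  have nonneg: "AE x in mu. 0 \<le> x" using pos by eventually_elim simp
  have "(\<integral>x. x \<partial>mu) \<noteq> 0"
  proof
    assume "(\<integral>x. x \<partial>mu) = 0"
    then have "AE x in mu. x = 0"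
      using integral_nonneg_eq_0_iff_AE[OF int nonneg] by simp
    with pos have "AE x in mu. False" by eventually_elim auto
    then show False by simp
  qed
  moreover have "0 \<le> (\<integral>x. x \<partial>mu)" using nonneg by (rule integral_nonneg_AE)
  ultimately show ?thesis by simp
qed

text \<open>The constant is fixed before \<open>n\<close> and \<open>h\<close>, so the bound passes
  to the supremum over test functions. One integrable function \<open>R\<close> dominates the
  conditional error at every positive weight vector, and its mean is taken term by term. The
  hypothesis \<open>1 \<le> m / 2 * real n\<close> makes the threshold \<open>c * real n\<close>
  admissible in \<open>heavy_weights\<close>.\<close>

lemma law_distance_bound:
  assumes pos: "AE x in mu. x > 0" and k: "3 \<le> k"
  defines "m \<equiv> \<integral>x. x \<partial>mu" and "M \<equiv> \<integral>x. x ^ 2 \<partial>mu"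
  defines "lam \<equiv> 1 / (2 * real k) * (M / m) ^ k"
  obtains C where "\<And>n h. \<lbrakk>1 \<le> n; 1 \<le> m / 2 * real n; \<And>j. \<bar>h j\<bar> \<le> 1\<rbrakk> \<Longrightarrow>
    \<bar>expect_S mu n k h - measure_pmf.expectation (poisson_pmf lam) h\<bar> \<le> C * (1 / sqrt (real n))"
proof -
  note id_le = abs_le_majorant_sq
  have sq_le: "\<bar>x ^ 2\<bar> \<le> majorant x ^ 2" for x :: real
    using abs_le_majorant[of x] by (simp add: abs_le_square_iff[symmetric] majorant_def)
  have int_sq: "integrable mu (\<lambda>x. x ^ 2)"
    by (rule integrable_le_majorant[OF _ sq_le]) measurable
  have m: "0 < m" unfolding m_def by (rule mean_pos[OF pos])
  have "M \<noteq> 0"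
  proof
    assume "M = 0"
    then have "AE x in mu. x ^ 2 = 0"
      using integral_nonneg_eq_0_iff_AE[OF int_sq] by (auto simp: M_def)
    with pos have "AE x in mu. False" by eventually_elim auto
    then show False by simp
  qed
  moreover have "0 \<le> M" unfolding M_def by (intro integral_nonneg_AE) auto
  ultimately have M: "0 < M" by simp
  have lam: "0 < lam" unfolding lam_def using m M k by auto
  define c where "c = m / 2"
  have c: "0 < c" "c \<le> m" using m by (auto simp: c_def)
  define K1 where "K1 = fact k / c ^ k"
  define K2 where "K2 = M ^ k * real k ^ 2 / c ^ k"
  define K3 where "K3 = M ^ k * real k / c ^ Suc k"
  define K4 where "K4 = (real k + 2) * pair_bound k"
  define A1 where "A1 = real k * moment4 ^ (2 * k)"
  define A2 where "A2 = moment4 ^ 2"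
  define A3 where "A3 = (\<Sum>s\<le>2 * k. moment4 ^ s / c ^ Suc s)"
  have K: "0 \<le> K1" "0 \<le> K2" "0 \<le> K3" "0 \<le> K4"
    using c M by (auto simp: K1_def K2_def K3_def K4_def pair_bound_def)
  have A: "0 \<le> A1" "0 \<le> A2" "0 \<le> A3"
    using c moment4_ge_1 by (auto simp: A1_def A2_def A3_def intro!: sum_nonneg)
  define C where "C = 2 * exp lam * (K1 * (1 + A1) + K2 + K3 * (1 + A2) + K4 * A3) + 8 / m ^ 2 * A2"
  show thesis
  proof (rule that[of C])
    fix n :: nat and h :: "nat \<Rightarrow> real"
    assume n: "1 \<le> n" and cn: "1 \<le> m / 2 * real n" and h: "\<And>j. \<bar>h j\<bar> \<le> 1"
    interpret W: prob_space "weights n" by (intro prob_space_PiM prob_space_axioms)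
    define t where "t = 1 / sqrt (real n)"
    define P where "P = measure_pmf.expectation (poisson_pmf lam) h"
    define F where "F w = (\<Sum>G\<in>graphs n. grg_prob w n G * h (num_cycles k n G))" for w
    define Y where "Y w = (elem_sym n k (\<lambda>i. w i ^ 2) - real (n choose k) * M ^ k) / real n ^ k" for w
    define Z where "Z w = (\<Sum>i=1..n. w i) / real n - m" for w
    define T where "T = cluster_sum (2 * k) n (c * real n)"
    \<comment> \<open>The last summand takes care of small total weight, the others of its
      complement; all are nonnegative, so their sum covers both cases.\<close>
    define R where "R w = 2 * exp lam * (K1 * (t + Y w ^ 2 / t) + K2 / real n + K3 * (t + Z w ^ 2 / t) + K4 * T w)
      + 8 / m ^ 2 * Z w ^ 2" for w
    have t: "0 < t" using n by (simp add: t_def)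
    have t_sq: "1 / real n = t * t" using n by (simp add: t_def)
    have "t \<le> 1" using n by (simp add: t_def)
    then have t_le: "1 / real n \<le> t" unfolding t_sq using t by (simp add: mult_left_le)
    have P: "\<bar>P\<bar> \<le> 1" unfolding P_def by (rule abs_poisson_expectation_le[of h lam, OF h])
    have T_nonneg: "0 \<le> T w" for w unfolding T_def using c by (intro cluster_sum_nonneg) auto

    have pointwise: "\<bar>F w - P\<bar> \<le> R w" if w: "\<forall>i\<in>{1..n}. 0 < w i" for w
    proof (cases "c * real n \<le> (\<Sum>i=1..n. w i)")
      case True
      interpret heavy_weights mu w n k "c * real n"
        by unfold_locales (use k w cn True in \<open>auto simp: c_def\<close>)
      let ?L = "\<Sum>i=1..n. w i" and ?e = "elem_sym n k (\<lambda>i. w i ^ 2)"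
      have "lam - fact k / (2 * real k) * ?e / ?L ^ k = (1 / (2 * real k)) * ((M / m) ^ k - fact k * ?e / ?L ^ k)"
        unfolding lam_def by (simp add: algebra_simps)
      then have "\<bar>lam - fact k / (2 * real k) * ?e / ?L ^ k\<bar> = (1 / (2 * real k)) * \<bar>fact k * ?e / ?L ^ k - (M / m) ^ k\<bar>"
        by (simp add: abs_mult abs_minus_commute)
      also have "\<dots> \<le> \<bar>fact k * ?e / ?L ^ k - (M / m) ^ k\<bar>"
        using k by (intro mult_left_le_one_le) auto
      also have "\<dots> \<le> K1 * \<bar>Y w\<bar> + K2 / real n + K3 * \<bar>Z w\<bar>"
        unfolding K1_def K2_def K3_def Y_def Z_def
        by (rule elem_sym_ratio_diff) (use c n True M in auto)
      also have "\<dots> \<le> K1 * (t + Y w ^ 2 / t) + K2 / real n + K3 * (t + Z w ^ 2 / t)"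
        using K t by (intro add_mono mult_left_mono abs_le_scaled_square) auto
      finally have "2 * exp lam * (\<bar>lam - fact k / (2 * real k) * ?e / ?L ^ k\<bar> + (real k + 2) * pair_bound k * T w)
         \<le> 2 * exp lam * (K1 * (t + Y w ^ 2 / t) + K2 / real n + K3 * (t + Z w ^ 2 / t) + K4 * T w)"
        by (intro mult_left_mono add_mono) (auto simp: K4_def)
      moreover have "\<bar>F w - P\<bar> \<le> 2 * exp lam * (\<bar>lam - fact k / (2 * real k) * ?e / ?L ^ k\<bar> + (real k + 2) * pair_bound k * T w)"
        unfolding F_def P_def T_def using h lam by (rule poisson_approx_weights)
      moreover have "0 \<le> 8 / m ^ 2 * Z w ^ 2" by simp
      ultimately show ?thesis unfolding R_def by linarith
    next
      case False
      \<comment> \<open>Chebyshev's inequality in pointwise form: \<open>Z w ^ 2\<close> is at least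
        \<open>m ^ 2 / 4\<close> here, so the constant 8 produces 2, the trivial bound for the
        error.\<close>
      then have "Z w < - (m / 2)" using n by (simp add: Z_def c_def field_simps)
      then have "(m / 2) ^ 2 \<le> Z w ^ 2"
        using m by (intro abs_le_square_iff[THEN iffD1]) auto
      then have "2 \<le> 8 / m ^ 2 * Z w ^ 2" using m by (simp add: field_simps power2_eq_square)
      moreover have "\<bar>F w\<bar> \<le> 1" unfolding F_def using w h by (intro abs_expect_le) auto
      moreover have "0 \<le> 2 * exp lam * (K1 * (t + Y w ^ 2 / t) + K2 / real n + K3 * (t + Z w ^ 2 / t) + K4 * T w)"
        using K t T_nonneg by (intro mult_nonneg_nonneg add_nonneg_nonneg) auto
      ultimately show ?thesis using P unfolding R_def by linarith
    qed

    have Y_sq: "Y w ^ 2 = (elem_sym n k (\<lambda>i. w i ^ 2) - real (n choose k) * M ^ k) ^ 2 / real n ^ (2 * k)" for w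
      unfolding Y_def power_divide power_mult[symmetric] by (simp only: mult.commute)
    \<comment> \<open>The total weight is the symmetric polynomial of degree 1, so the same variance
      bound serves both statistics.\<close>
    have Z_sq: "Z w ^ 2 = (elem_sym n 1 w - real (n choose 1) * m ^ 1) ^ 2 / real n ^ 2" for w
    proof -
      have eq: "elem_sym n 1 w - real (n choose 1) * m ^ 1 = real n * Z w"
        unfolding elem_sym_1 Z_def using n by (simp add: field_simps)
      show ?thesis unfolding eq using n by (simp add: power_mult_distrib)
    qed
    have k1: "1 \<le> k" using k by simp
    note varY = elem_sym_variance[of "\<lambda>x. x ^ 2" k n, OF _ sq_le k1, folded M_def]
    note varZ = elem_sym_variance[of "\<lambda>x. x" 1 n, OF _ id_le order.refl, folded m_def]
    have int_Y: "integrable (weights n) (\<lambda>w. Y w ^ 2)" and int_Z: "integrable (weights n) (\<lambda>w. Z w ^ 2)"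
      unfolding Y_sq Z_sq using varY(1) varZ(1) by (auto intro!: integrable_divide simp del: One_nat_def)
    have EY: "(\<integral>w. Y w ^ 2 \<partial>weights n) \<le> A1 / real n"
    proof -
      have "(\<integral>w. Y w ^ 2 \<partial>weights n) \<le> A1 * real n ^ (2 * k - 1) / real n ^ (2 * k)"
        unfolding Y_sq integral_divide_zero A1_def using varY(2) by (intro divide_right_mono) auto
      also have "real n ^ (2 * k) = real n * real n ^ (2 * k - 1)"
        using k by (subst power_Suc[symmetric]) (simp del: power_Suc)
      finally show ?thesis using n by simp
    qed
    have EZ: "(\<integral>w. Z w ^ 2 \<partial>weights n) \<le> A2 / real n"
    proof -
      have "(\<integral>w. Z w ^ 2 \<partial>weights n) \<le> real 1 * moment4 ^ (2 * 1) * real n ^ (2 * 1 - 1) / real n ^ 2"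
        unfolding Z_sq integral_divide_zero using varZ(2) by (intro divide_right_mono) auto
      then show ?thesis using n by (simp add: A2_def power2_eq_square)
    qed
    have int_T: "integrable (weights n) T" and ET: "(\<integral>w. T w \<partial>weights n) \<le> A3 / real n"
      unfolding T_def A3_def using cluster_sum_expectation[OF c(1) n] by auto
    have int_R: "integrable (weights n) R"
      unfolding R_def[abs_def]
      by (intro Bochner_Integration.integrable_add integrable_mult_right integrable_divide W.integrable_const int_Y int_Z int_T)
    have "(\<integral>w. R w \<partial>weights n) = 2 * exp lam * (K1 * (t + (\<integral>w. Y w ^ 2 \<partial>weights n) / t) + K2 / real n +
        K3 * (t + (\<integral>w. Z w ^ 2 \<partial>weights n) / t) + K4 * (\<integral>w. T w \<partial>weights n)) + 8 / m ^ 2 * (\<integral>w. Z w ^ 2 \<partial>weights n)"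
    proof -
      note int = Bochner_Integration.integrable_add integrable_mult_right integrable_divide W.integrable_const int_Y int_Z int_T
      have const: "(\<integral>w. a \<partial>weights n) = a" for a :: real by (simp add: W.prob_space del: One_nat_def)
      have add: "(\<integral>w. f w + g w \<partial>weights n) = (\<integral>w. f w \<partial>weights n) + (\<integral>w. g w \<partial>weights n)"
        if "integrable (weights n) f" "integrable (weights n) g" for f g :: "(nat \<Rightarrow> real) \<Rightarrow> real"
        using that by (rule Bochner_Integration.integral_add)
      show ?thesis
        unfolding R_def[abs_def]
        by (simp only: add int integral_mult_right_zero integral_divide_zero const)
    qed
    also have "\<dots> \<le> 2 * exp lam * (K1 * (t + (A1 / real n) / t) + K2 / real n +
        K3 * (t + (A2 / real n) / t) + K4 * (A3 / real n)) + 8 / m ^ 2 * (A2 / real n)"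
      using K t EY EZ ET by (intro add_mono mult_left_mono divide_right_mono) auto
    also have "\<dots> \<le> 2 * exp lam * (K1 * (t + A1 * t) + K2 * t + K3 * (t + A2 * t) + K4 * (A3 * t)) + 8 / m ^ 2 * (A2 * t)"
    proof -
      \<comment> \<open>This is where the choice of \<open>t\<close> pays off:
        \<open>t * t = 1 / real n\<close>, so a variance of order \<open>1 / n\<close> divided by
        \<open>t\<close> leaves \<open>t\<close>.\<close>
      have 1: "a / real n / t = a * t" for a
      proof -
        have "a / real n / t = a * (1 / real n) / t" by simp
        also have "\<dots> = a * t" unfolding t_sq using t by simp
        finally show ?thesis .
      qed
      have 2: "a / real n \<le> a * t" if "0 \<le> a" for a
        using mult_left_mono[OF t_le that] by simp
      show ?thesis unfolding 1
        using K A 2 by (intro add_mono mult_left_mono) auto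
    qed
    also have "\<dots> = C * t" by (simp add: C_def algebra_simps)
    finally have ER: "(\<integral>w. R w \<partial>weights n) \<le> C * t" .

    have F_bound: "AE w in weights n. \<bar>F w\<bar> \<le> 1"
      using AE_weights_pos[OF pos] by eventually_elim (use h in \<open>auto simp: F_def intro!: abs_expect_le\<close>)
    have int_F: "integrable (weights n) F"
      by (rule W.integrable_const_bound[of _ 1])
        (use F_bound measurable_conditional_expectation in \<open>auto simp: F_def[abs_def]\<close>)
    have int_FP: "integrable (weights n) (\<lambda>w. F w - P)"
      using int_F W.integrable_const by (rule Bochner_Integration.integrable_diff)
    have "expect_S mu n k h - P = (\<integral>w. F w - P \<partial>weights n)"
      unfolding expect_S_def F_def[symmetric]
      using Bochner_Integration.integral_diff[OF int_F W.integrable_const[of P]] W.prob_space by simp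
    then have "\<bar>expect_S mu n k h - P\<bar> \<le> (\<integral>w. \<bar>F w - P\<bar> \<partial>weights n)"
      using integral_abs_bound[of "weights n" "\<lambda>w. F w - P"] by simp
    also have "\<dots> \<le> (\<integral>w. R w \<partial>weights n)"
    proof (rule integral_mono_AE[OF integrable_abs[OF int_FP] int_R])
      show "AE w in weights n. \<bar>F w - P\<bar> \<le> R w"
        using AE_weights_pos[OF pos] by eventually_elim (rule pointwise)
    qed
    also have "\<dots> \<le> C * t" by (rule ER)
    finally show "\<bar>expect_S mu n k h - measure_pmf.expectation (poisson_pmf lam) h\<bar> \<le> C * (1 / sqrt (real n))"
      by (simp add: P_def t_def)
  qed
qed

end

section \<open>Passage to the supremum over test functions\<close>

theorem theorem1:
  fixes mu :: "real measure" and k :: nat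
  assumes "prob_space mu"
    and "sets mu = sets borel"
    and "AE x in mu. x > 0"
    and "k \<ge> 3"
    and "(\<lambda>x. measure mu {y. y > x}) \<in> o[at_top](\<lambda>x. x powr (- (2 * real k + 1)))"
  shows "(\<lambda>n. law_dist mu n k
            ((1 / (2 * real k)) * ((\<integral>x. x ^ 2 \<partial>mu) / (\<integral>x. x \<partial>mu)) ^ k))
         \<in> O[sequentially](\<lambda>n. 1 / sqrt (real n))"
proof -
  interpret prob_space mu by fact
  interpret iid_weights mu
    by unfold_locales (use assms integrable_power4_of_tail in auto)
  let ?m = "\<integral>x. x \<partial>mu"
  let ?lam = "(1 / (2 * real k)) * ((\<integral>x. x ^ 2 \<partial>mu) / ?m) ^ k"
  obtain C where C: "\<And>n h. \<lbrakk>1 \<le> n; 1 \<le> ?m / 2 * real n; \<And>j. \<bar>h j\<bar> \<le> 1\<rbrakk> \<Longrightarrow>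
    \<bar>expect_S mu n k h - measure_pmf.expectation (poisson_pmf ?lam) h\<bar> \<le> C * (1 / sqrt (real n))"
    using law_distance_bound[OF assms(3,4)] by blast
  have m: "0 < ?m" using mean_pos[OF assms(3)] .
  have "\<bar>law_dist mu n k ?lam\<bar> \<le> C * (1 / sqrt (real n))" if n: "1 \<le> n" "1 \<le> ?m / 2 * real n" for n
  proof -
    let ?H = "{h. sup_norm_one h}"
    let ?d = "\<lambda>h. \<bar>expect_S mu n k h - measure_pmf.expectation (poisson_pmf ?lam) (\<lambda>m. h m)\<bar>"
    \<comment> \<open>The constant 1 makes the range of the supremum nonempty and also bounds the
      supremum below by a nonnegative term, which handles the absolute value in the
      O-notation.\<close>
    have H1: "(\<lambda>_. 1) \<in> ?H" by (simp add: sup_norm_one_def)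
    have le: "?d h \<le> C * (1 / sqrt (real n))" if "h \<in> ?H" for h
    proof (rule C[OF n])
      fix j show "\<bar>h j\<bar> \<le> 1"
        using that cSUP_upper[of j UNIV "\<lambda>m. \<bar>h m\<bar>"] by (simp add: sup_norm_one_def)
    qed
    have "law_dist mu n k ?lam \<le> C * (1 / sqrt (real n))"
      unfolding law_dist_def using H1 le by (intro cSUP_least) auto
    moreover have "0 \<le> law_dist mu n k ?lam"
    proof -
      have "?d (\<lambda>_. 1) \<le> law_dist mu n k ?lam"
        unfolding law_dist_def using le by (intro cSUP_upper[OF H1] bdd_aboveI2) auto
      then show ?thesis by linarith
    qed
    ultimately show ?thesis by simp
  qed
  moreover have "\<forall>\<^sub>F n in sequentially. 1 \<le> n \<and> 1 \<le> ?m / 2 * real n"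
  proof (intro eventually_conj eventually_ge_at_top)
    have "\<forall>\<^sub>F n in sequentially. 1 \<le> a * real n" if "0 < a" for a :: real
      using that by real_asymp
    from this[of "?m / 2"] show "\<forall>\<^sub>F n in sequentially. 1 \<le> ?m / 2 * real n" using m by simp
  qed
  ultimately show ?thesis
    by (intro bigoI[of _ C]) (auto elim!: eventually_mono)
qed

end
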